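(* Let $n\ge 2$, let $1\le h(1)\le n$, and let $h=(h(1),n,\ldots,n)$. Let $R=\mathbb{C}[x_1,\ldots,x_n,y_1,\ldots,y_n]/I$, where $I$ is the ideal generated by (1) $y_ky_{k'}$ for $1\le k\ne k'\le n$; (2) $x_1y_k$ for $1\le k\le n$; (3) $\left(\prod_{\ell=h(1)+1}^n(-x_\ell)\right)y_k-\prod_{\ell=2}^n(-x_\ell)$ for $1\le k\le n$; (4) $\sum_{k=1}^n y_k-\prod_{\ell=2}^{h(1)}(x_1-x_\ell)$; (5) the elementary symmetric polynomials $e_i(x_1,\ldots,x_n)$ for $1\le i\le n$ (empty products are $1$). Then the classes in $R$ of the following elements form a $\mathbb{C}$-basis of $R$ (equivalently, of $H^*(\mathrm{Hess}(S,h);\mathbb{C})$): (i) the monomials $x_1^{i_1}x_2^{i_2}\cdots x_n^{i_n}$ with $0\le i_j\le n-j$ for all $j$ that are not divisible by $\prod_{\ell=1}^{h(1)}x_\ell$; (ii) the elements $x_n^{\ell_1}x_{n-1}^{\ell_2}\cdots x_2^{\ell_{n-1}}(y_{k+1}-y_1)$ with $0\le \ell_j\le n-1-j$ for all $j$ and $1\le k\le n-1$, such that the monomial $x_n^{\ell_1}\cdots x_2^{\ell_{n-1}}$ is not divisible by $\prod_{\ell=h(1)+1}^n x_\ell$.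
   Context: A Hessenberg function is $h:[n]\to[n]$ with $i\le h(i)$ and $h(i)\le h(i+1)$. For a regular semisimple $n\times n$ matrix $S$, $\mathrm{Hess}(S,h)=\{V_\bullet\in \mathrm{Fl}(\mathbb{C}^n): SV_i\subseteq V_{h(i)}\ \forall i\}$. For $h=(h(1),n,\ldots,n)$ it is known (Abe–Horiguchi–Masuda) that $H^*(\mathrm{Hess}(S,h);\mathbb{C})\cong R$ with $\deg x_i=2$, $\deg y_k=2(h(1)-1)$, where $x_i,y_k$ correspond to specific equivariant cohomology classes. A monomial "not divisible by" the empty product $1$ does not exist, so if $h(1)=n$ the set (ii) is empty. *)

theory Defs
  imports
    "HOL-Library.Poly_Mapping"
    "HOL-Algebra.QuotRing"
    "Jordan_Normal_Form.VS_Connect"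
begin

datatype hvar = XVar nat | YVar nat

type_synonym hpoly = "(hvar \<Rightarrow>\<^sub>0 nat) \<Rightarrow>\<^sub>0 complex"

definition const_poly :: "complex \<Rightarrow> hpoly" where
  "const_poly c = Poly_Mapping.single 0 c"

definition var_poly :: "hvar \<Rightarrow> hpoly" where
  "var_poly v = Poly_Mapping.single (Poly_Mapping.single v 1) 1"

definition xvar :: "nat \<Rightarrow> hpoly" where
  "xvar i = var_poly (XVar i)"

definition yvar :: "nat \<Rightarrow> hpoly" where
  "yvar k = var_poly (YVar k)"

definition hvars :: "nat \<Rightarrow> hvar set" where
  "hvars n = XVar ` {1..n} \<union> YVar ` {1..n}"

text \<open>The type \<^typ>\<open>hpoly\<close> has infinitely many variables; the carrier cuts it down to the
  polynomials in which only the \<open>2 * n\<close> variables of \<^term>\<open>hvars n\<close> occur.\<close>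

definition poly_ring :: "nat \<Rightarrow> hpoly ring" where
  "poly_ring n =
     \<lparr>carrier = {p. \<forall>m \<in> Poly_Mapping.keys p. Poly_Mapping.keys m \<subseteq> hvars n},
      mult = (*), one = 1, zero = 0, add = (+)\<rparr>"

definition elem_sym :: "nat \<Rightarrow> nat \<Rightarrow> hpoly" where
  "elem_sym n i = (\<Sum>A | A \<subseteq> {1..n} \<and> card A = i. \<Prod>j\<in>A. xvar j)"

text \<open>Here and below \<open>h1\<close> stands for the value $h(1)$.\<close>

definition hess_relations :: "nat \<Rightarrow> nat \<Rightarrow> hpoly set" where
  "hess_relations n h1 =
     {yvar k * yvar k' | k k'. k \<in> {1..n} \<and> k' \<in> {1..n} \<and> k \<noteq> k'}
   \<union> {xvar 1 * yvar k | k. k \<in> {1..n}}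
   \<union> {(\<Prod>l=h1+1..n. - xvar l) * yvar k - (\<Prod>l=2..n. - xvar l) | k. k \<in> {1..n}}
   \<union> {(\<Sum>k=1..n. yvar k) - (\<Prod>l=2..h1. xvar 1 - xvar l)}
   \<union> {elem_sym n i | i. i \<in> {1..n}}"

definition hess_ideal :: "nat \<Rightarrow> nat \<Rightarrow> hpoly set" where
  "hess_ideal n h1 = genideal (poly_ring n) (hess_relations n h1)"

definition hess_class :: "nat \<Rightarrow> nat \<Rightarrow> hpoly \<Rightarrow> hpoly set" where
  "hess_class n h1 p = hess_ideal n h1 +>\<^bsub>poly_ring n\<^esub> p"

text \<open>The quotient ring, with the scalar multiplication that makes it a complex algebra:
  multiplication by the class of a constant polynomial.\<close>

definition hess_algebra :: "nat \<Rightarrow> nat \<Rightarrow> (complex, hpoly set) module" where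
  "hess_algebra n h1 =
     (let Q = poly_ring n Quot hess_ideal n h1 in
      \<lparr>carrier = carrier Q, mult = mult Q, one = one Q, zero = zero Q, add = add Q,
       smult = (\<lambda>c A. hess_class n h1 (const_poly c) \<otimes>\<^bsub>Q\<^esub> A)\<rparr>)"

text \<open>Divisibility is taken in the type \<^typ>\<open>hpoly\<close>; between monomials in the variables of
  \<^term>\<open>hvars n\<close> it is the same relation as divisibility in \<^term>\<open>poly_ring n\<close>.\<close>

definition x_elements :: "nat \<Rightarrow> nat \<Rightarrow> hpoly set" where
  "x_elements n h1 =
     {(\<Prod>j=1..n. xvar j ^ i j) | i :: nat \<Rightarrow> nat.
        (\<forall>j\<in>{1..n}. i j \<le> n - j) \<and>
        \<not> (\<Prod>l=1..h1. xvar l) dvd (\<Prod>j=1..n. xvar j ^ i j)}"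

definition y_elements :: "nat \<Rightarrow> nat \<Rightarrow> hpoly set" where
  "y_elements n h1 =
     {(\<Prod>j=1..n-1. xvar (n + 1 - j) ^ e j) * (yvar (k + 1) - yvar 1) | (e :: nat \<Rightarrow> nat) k.
        (\<forall>j\<in>{1..n-1}. e j \<le> n - 1 - j) \<and> k \<in> {1..n-1} \<and>
        \<not> (\<Prod>l=h1+1..n. xvar l) dvd (\<Prod>j=1..n-1. xvar (n + 1 - j) ^ e j)}"

lemma carrier_poly_ring:
  "p \<in> carrier (poly_ring n) \<longleftrightarrow> (\<forall>m \<in> Poly_Mapping.keys p. Poly_Mapping.keys m \<subseteq> hvars n)"
  by (simp add: poly_ring_def)

lemma poly_ring_simps [simp]:
  "mult (poly_ring n) = (*)" "one (poly_ring n) = 1"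
  "zero (poly_ring n) = 0" "add (poly_ring n) = (+)"
  by (simp_all add: poly_ring_def)

lemma poly_ring_zero: "0 \<in> carrier (poly_ring n)"
  and poly_ring_one: "1 \<in> carrier (poly_ring n)"
  and poly_ring_const: "const_poly c \<in> carrier (poly_ring n)"
  by (auto simp: carrier_poly_ring const_poly_def)

lemma poly_ring_add:
  "p \<in> carrier (poly_ring n) \<Longrightarrow> q \<in> carrier (poly_ring n) \<Longrightarrow> p + q \<in> carrier (poly_ring n)"
  unfolding carrier_poly_ring using Poly_Mapping.keys_add[of p q] by blast

lemma poly_ring_uminus: "p \<in> carrier (poly_ring n) \<Longrightarrow> - p \<in> carrier (poly_ring n)"
  by (simp add: carrier_poly_ring in_keys_iff)

lemma poly_ring_mult:
  assumes "p \<in> carrier (poly_ring n)" "q \<in> carrier (poly_ring n)"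
  shows "p * q \<in> carrier (poly_ring n)"
  unfolding carrier_poly_ring
proof
  fix m assume "m \<in> Poly_Mapping.keys (p * q)"
  then obtain a b where "a \<in> Poly_Mapping.keys p" "b \<in> Poly_Mapping.keys q" "m = a + b"
    using Poly_Mapping.keys_mult[of p q] by auto
  then show "Poly_Mapping.keys m \<subseteq> hvars n"
    using assms Poly_Mapping.keys_add[of a b] unfolding carrier_poly_ring by blast
qed

lemma cring_poly_ring: "cring (poly_ring n)"
proof (rule cringI)
  show "abelian_group (poly_ring n)"
  proof (rule abelian_groupI)
    fix p assume "p \<in> carrier (poly_ring n)"
    then show "\<exists>q\<in>carrier (poly_ring n). q \<oplus>\<^bsub>poly_ring n\<^esub> p = \<zero>\<^bsub>poly_ring n\<^esub>"
      by (intro bexI[of _ "- p"]) (auto simp: poly_ring_uminus)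
  qed (auto simp: poly_ring_add poly_ring_zero algebra_simps)
  show "comm_monoid (poly_ring n)"
    by (rule comm_monoidI) (auto simp: poly_ring_mult poly_ring_one algebra_simps)
qed (auto simp: algebra_simps)

lemma poly_ring_diff:
  "p \<in> carrier (poly_ring n) \<Longrightarrow> q \<in> carrier (poly_ring n) \<Longrightarrow> p - q \<in> carrier (poly_ring n)"
  using poly_ring_add[of p n "- q"] poly_ring_uminus[of q n] by simp

lemma poly_ring_sum:
  "(\<And>i. i \<in> A \<Longrightarrow> f i \<in> carrier (poly_ring n)) \<Longrightarrow> sum f A \<in> carrier (poly_ring n)"
  by (induction A rule: infinite_finite_induct) (auto simp: poly_ring_zero poly_ring_add)

lemma poly_ring_prod:
  "(\<And>i. i \<in> A \<Longrightarrow> f i \<in> carrier (poly_ring n)) \<Longrightarrow> prod f A \<in> carrier (poly_ring n)"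
  by (induction A rule: infinite_finite_induct) (auto simp: poly_ring_one poly_ring_mult)

lemma poly_ring_power: "p \<in> carrier (poly_ring n) \<Longrightarrow> p ^ k \<in> carrier (poly_ring n)"
  by (induction k) (auto simp: poly_ring_one poly_ring_mult)

lemma poly_ring_x: "i \<in> {1..n} \<Longrightarrow> xvar i \<in> carrier (poly_ring n)"
  and poly_ring_y: "i \<in> {1..n} \<Longrightarrow> yvar i \<in> carrier (poly_ring n)"
  by (auto simp: carrier_poly_ring xvar_def yvar_def var_poly_def hvars_def)

lemmas poly_ring_closed = poly_ring_zero poly_ring_one poly_ring_const poly_ring_add
  poly_ring_uminus poly_ring_mult poly_ring_diff poly_ring_sum poly_ring_prod poly_ring_power
  poly_ring_x poly_ring_y

lemma hess_relations_carrier: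
  assumes "1 \<le> h1" "h1 \<le> n"
  shows "hess_relations n h1 \<subseteq> carrier (poly_ring n)"
proof -
  have "elem_sym n i \<in> carrier (poly_ring n)" for i
    unfolding elem_sym_def by (intro poly_ring_sum poly_ring_prod poly_ring_x) auto
  then show ?thesis
    using assms unfolding hess_relations_def
    by (auto intro!: poly_ring_closed)
qed

lemma x_elements_carrier: "x_elements n h1 \<subseteq> carrier (poly_ring n)"
  unfolding x_elements_def by (auto intro!: poly_ring_prod poly_ring_power poly_ring_x)

lemma y_elements_carrier: "y_elements n h1 \<subseteq> carrier (poly_ring n)"
  unfolding y_elements_def
  by (auto intro!: poly_ring_mult poly_ring_diff poly_ring_prod poly_ring_power poly_ring_x poly_ring_y)

lemma ideal_hess_ideal:
  assumes "1 \<le> h1" "h1 \<le> n"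
  shows "ideal (hess_ideal n h1) (poly_ring n)"
  unfolding hess_ideal_def
  by (rule ring.genideal_ideal[OF cring.axioms(1)[OF cring_poly_ring] hess_relations_carrier[OF assms]])

lemma vectorspace_hess_algebra:
  assumes "1 \<le> h1" "h1 \<le> n"
  shows "vectorspace class_ring (hess_algebra n h1)"
proof -
  define Q where "Q = poly_ring n Quot hess_ideal n h1"
  interpret I: ideal "hess_ideal n h1" "poly_ring n" by (rule ideal_hess_ideal[OF assms])
  interpret Q: cring Q
    unfolding Q_def by (rule I.quotient_is_cring[OF cring_poly_ring])
  have hom: "hess_class n h1 \<in> Ring.ring_hom (poly_ring n) Q"
    using I.rcos_ring_hom unfolding Q_def hess_class_def[abs_def] .
  have K [simp]: "hess_class n h1 (const_poly c) \<in> carrier Q" for c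
    using ring_hom_closed[OF hom poly_ring_const] .
  have Kadd: "hess_class n h1 (const_poly (c + d)) =
      hess_class n h1 (const_poly c) \<oplus>\<^bsub>Q\<^esub> hess_class n h1 (const_poly d)" for c d
    using ring_hom_add[OF hom poly_ring_const poly_ring_const, of c d]
    by (simp add: const_poly_def single_add)
  have Kmult: "hess_class n h1 (const_poly (c * d)) =
      hess_class n h1 (const_poly c) \<otimes>\<^bsub>Q\<^esub> hess_class n h1 (const_poly d)" for c d
    using ring_hom_mult[OF hom poly_ring_const poly_ring_const, of c d]
    by (simp add: const_poly_def mult_single)
  have Kone: "hess_class n h1 (const_poly 1) = \<one>\<^bsub>Q\<^esub>"
    using ring_hom_one[OF hom] by (simp add: const_poly_def)
  have simps: "carrier (hess_algebra n h1) = carrier Q" "zero (hess_algebra n h1) = zero Q"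
    "add (hess_algebra n h1) = add Q"
    "smult (hess_algebra n h1) = (\<lambda>c A. hess_class n h1 (const_poly c) \<otimes>\<^bsub>Q\<^esub> A)"
    by (simp_all add: hess_algebra_def Q_def Let_def)
  have fld: "field (class_ring :: complex ring)"
    by unfold_locales
  have neg: "\<exists>w\<in>carrier Q. v \<oplus>\<^bsub>Q\<^esub> w = \<zero>\<^bsub>Q\<^esub>" if "v \<in> carrier Q" for v
    using that Q.r_neg[OF that] Q.a_inv_closed[OF that] by blast
  have "Module.module (class_ring :: complex ring) (hess_algebra n h1)"
    by (rule module_criteria)
      (use neg in \<open>auto simp: simps Kadd Kmult Kone Q.m_assoc Q.l_distr Q.r_distr Q.a_ac
        intro: fld[THEN field.axioms(1), THEN domain.axioms(1)]\<close>)
  then show ?thesis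
    using fld by (simp add: vectorspace_def)
qed

end

theory Submission
  imports Defs "HOL-Combinatorics.Permutations" "HOL-Library.Function_Algebras"
    "HOL-Computational_Algebra.Formal_Power_Series"
begin

text \<open>Write $h$ for $h(1)$, $D = \prod_{l=2}^{h} (x_1 - x_l)$ and $z_k = y_{k+1} - y_1$.

  Spanning: $y_k^2 = D y_k$ and $n y_1 = D - \sum_k z_k$ in the quotient, so it is generated by $1$ and
  the $z_k$ as a module over the polynomials in the $x_l$. Modulo the elementary symmetric
  polynomials the standard monomials span, because the complete symmetric polynomial of degree
  $m - j + 1$ in $x_1, \dots, x_j$ vanishes. Since $x_1 D = 0$, a standard monomial divisible by
  $x_1 \cdots x_h$ can be traded for higher powers of $x_1$. Since $x_1$ and $x_{h+1} \cdots x_n$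
  annihilate $z_k$, its multiples are spanned by the standard monomials in $x_n, \dots, x_2$ not
  divisible by that product. A count shows that at most $n!$ elements remain.

  Independence: the relations are homogeneous for $\deg x_l = 1$, $\deg y_k = h - 1$, and they are the
  leading forms of relations satisfied by the $n!$ points $x_l = w(l)$,
  $y_k = [w(1) = k] \prod_{l=2}^{h} (k - w(l))$ for permutations $w$. Hence a spanning set of homogeneous
  elements of the quotient also spans the functions on these points, compatibly with the degree
  filtrations; having at most $n!$ elements it is independent on the points, and the leading part of
  a linear relation in the quotient would be a dependency there.\<close>

section \<open>Evaluation and generation of polynomials\<close>

text \<open>Values lie in univariate polynomials instead of complex numbers, so that the weight of a
  monomial can later be recorded as an exponent.\<close>

definition eval_monom :: "(hvar \<Rightarrow> complex poly) \<Rightarrow> (hvar \<Rightarrow>\<^sub>0 nat) \<Rightarrow> complex poly" where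
  "eval_monom f m = (\<Prod>v\<in>Poly_Mapping.keys m. f v ^ Poly_Mapping.lookup m v)"

definition eval_hpoly :: "(hvar \<Rightarrow> complex poly) \<Rightarrow> hpoly \<Rightarrow> complex poly" where
  "eval_hpoly f p = (\<Sum>m\<in>Poly_Mapping.keys p. Polynomial.smult (Poly_Mapping.lookup p m) (eval_monom f m))"

lemma eval_monom_superset:
  assumes "finite A" "Poly_Mapping.keys m \<subseteq> A"
  shows "eval_monom f m = (\<Prod>v\<in>A. f v ^ Poly_Mapping.lookup m v)"
  unfolding eval_monom_def
  by (rule prod.mono_neutral_left) (use assms in \<open>auto simp: in_keys_iff\<close>)

lemma eval_monom_add: "eval_monom f (a + b) = eval_monom f a * eval_monom f b"
proof -
  let ?A = "Poly_Mapping.keys a \<union> Poly_Mapping.keys b"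
  have "eval_monom f (a + b) = (\<Prod>v\<in>?A. f v ^ Poly_Mapping.lookup (a + b) v)"
    by (rule eval_monom_superset) (auto simp: Poly_Mapping.keys_add)
  also have "\<dots> = eval_monom f a * eval_monom f b"
    by (simp add: lookup_add power_add prod.distrib eval_monom_superset[of ?A])
  finally show ?thesis .
qed

lemma eval_hpoly_superset:
  assumes "finite A" "Poly_Mapping.keys p \<subseteq> A"
  shows "eval_hpoly f p = (\<Sum>m\<in>A. Polynomial.smult (Poly_Mapping.lookup p m) (eval_monom f m))"
  unfolding eval_hpoly_def
  by (rule sum.mono_neutral_left) (use assms in \<open>auto simp: in_keys_iff\<close>)

lemma eval_hpoly_add: "eval_hpoly f (p + q) = eval_hpoly f p + eval_hpoly f q"
proof -
  let ?A = "Poly_Mapping.keys p \<union> Poly_Mapping.keys q"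
  have "eval_hpoly f (p + q) =
      (\<Sum>m\<in>?A. Polynomial.smult (Poly_Mapping.lookup (p + q) m) (eval_monom f m))"
    by (rule eval_hpoly_superset) (auto simp: Poly_Mapping.keys_add)
  also have "\<dots> = eval_hpoly f p + eval_hpoly f q"
    by (simp add: lookup_add Polynomial.smult_add_left sum.distrib eval_hpoly_superset[of ?A])
  finally show ?thesis .
qed

lemma eval_hpoly_0 [simp]: "eval_hpoly f 0 = 0"
  by (simp add: eval_hpoly_def)

lemma eval_hpoly_sum: "eval_hpoly f (sum g A) = (\<Sum>a\<in>A. eval_hpoly f (g a))"
  by (induction A rule: infinite_finite_induct) (auto simp: eval_hpoly_add)

lemma eval_hpoly_single: "eval_hpoly f (Poly_Mapping.single m c) = Polynomial.smult c (eval_monom f m)"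
  by (simp add: eval_hpoly_def)

lemma hpoly_eq_sum_single:
  fixes p :: hpoly
  shows "p = (\<Sum>m\<in>Poly_Mapping.keys p. Poly_Mapping.single m (Poly_Mapping.lookup p m))"
proof (rule poly_mapping_eqI)
  fix m
  show "Poly_Mapping.lookup p m = Poly_Mapping.lookup
      (\<Sum>m\<in>Poly_Mapping.keys p. Poly_Mapping.single m (Poly_Mapping.lookup p m)) m"
    by (auto simp: lookup_sum lookup_single when_def in_keys_iff)
qed

lemma eval_hpoly_mult: "eval_hpoly f (p * q) = eval_hpoly f p * eval_hpoly f q"
proof -
  let ?s = "\<lambda>p m. Poly_Mapping.single m (Poly_Mapping.lookup p m) :: hpoly"
  have "p * q = (\<Sum>a\<in>Poly_Mapping.keys p. \<Sum>b\<in>Poly_Mapping.keys q. ?s p a * ?s q b)"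
    by (subst hpoly_eq_sum_single[of p], subst hpoly_eq_sum_single[of q]) (rule sum_product)
  then have "eval_hpoly f (p * q) = (\<Sum>a\<in>Poly_Mapping.keys p. \<Sum>b\<in>Poly_Mapping.keys q.
      Polynomial.smult (Poly_Mapping.lookup p a) (eval_monom f a) * Polynomial.smult (Poly_Mapping.lookup q b) (eval_monom f b))"
    by (simp add: eval_hpoly_sum mult_single eval_hpoly_single eval_monom_add mult.commute)
  then show ?thesis
    by (simp add: eval_hpoly_def sum_product)
qed

lemma eval_hpoly_const: "eval_hpoly f (const_poly c) = [:c:]"
  by (simp add: const_poly_def eval_hpoly_single eval_monom_def)

lemma eval_hpoly_var [simp]: "eval_hpoly f (var_poly v) = f v"
  by (simp add: var_poly_def eval_hpoly_single eval_monom_def)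

lemma const_poly_1: "const_poly 1 = 1"
  by (simp add: const_poly_def)

lemma const_poly_uminus_1: "const_poly (-1) = -1"
  by (simp add: const_poly_def single_uminus)

lemma const_poly_add: "const_poly (a + b) = const_poly a + const_poly b"
  by (simp add: const_poly_def single_add)

lemma const_poly_mult: "const_poly (a * b) = const_poly a * const_poly b"
  by (simp add: const_poly_def mult_single)

lemma const_poly_0 [simp]: "const_poly 0 = 0"
  by (simp add: const_poly_def)

lemma eval_hpoly_1 [simp]: "eval_hpoly f 1 = 1"
  using eval_hpoly_const[of f 1] by (simp add: const_poly_1)

lemma eval_hpoly_uminus: "eval_hpoly f (- p) = - eval_hpoly f p"
  using eval_hpoly_add[of f p "- p"] by (simp add: eq_neg_iff_add_eq_0 add.commute)

lemma eval_hpoly_diff: "eval_hpoly f (p - q) = eval_hpoly f p - eval_hpoly f q"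
  using eval_hpoly_add[of f p "- q"] by (simp add: eval_hpoly_uminus)

lemma eval_hpoly_prod: "eval_hpoly f (prod g A) = (\<Prod>a\<in>A. eval_hpoly f (g a))"
  by (induction A rule: infinite_finite_induct) (auto simp: eval_hpoly_mult)

lemma eval_hpoly_power: "eval_hpoly f (p ^ k) = eval_hpoly f p ^ k"
  by (induction k) (auto simp: eval_hpoly_mult)

lemmas eval_hpoly_simps = eval_hpoly_add eval_hpoly_sum eval_hpoly_mult eval_hpoly_const
  eval_hpoly_uminus eval_hpoly_diff eval_hpoly_prod eval_hpoly_power

text \<open>The subalgebra generated by \<open>G\<close>. The last rule multiplies by one generator
  only, so inductions treat a single variable at a time; closure under products is
  \<open>generated_times\<close>.\<close>

inductive_set generated :: "hpoly set \<Rightarrow> hpoly set" for G where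
  const: "const_poly c \<in> generated G"
| add: "p \<in> generated G \<Longrightarrow> q \<in> generated G \<Longrightarrow> p + q \<in> generated G"
| mult: "p \<in> generated G \<Longrightarrow> g \<in> G \<Longrightarrow> p * g \<in> generated G"

lemma generated_times:
  assumes "p \<in> generated G" "q \<in> generated G" shows "p * q \<in> generated G"
  using assms(2)
proof induction
  case (const c)
  show ?case using assms(1)
  proof induction
    case (const d)
    then show ?case using generated.const[of "d * c"] by (simp add: const_poly_mult)
  next
    case (add p q)
    then show ?case by (simp add: distrib_right generated.add)
  next
    case (mult p g)
    then have "p * const_poly c * g \<in> generated G" by (blast intro: generated.mult)
    then show ?case by (simp add: mult_ac)
  qed
next
  case (add q r)
  then show ?case by (simp add: distrib_left generated.add)
next
  case (mult q g)
  then have "p * q * g \<in> generated G" by (blast intro: generated.mult)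
  then show ?case by (simp add: mult_ac)
qed

lemma generated_mono:
  assumes "p \<in> generated G" "G \<subseteq> H" shows "p \<in> generated H"
  using assms by induction (auto intro: generated.intros)

lemma generated_1: "1 \<in> generated G"
  using generated.const[of 1] by (simp add: const_poly_1)

lemma generated_0: "0 \<in> generated G"
  using generated.const[of 0] by simp

lemma generated_uminus: "p \<in> generated G \<Longrightarrow> - p \<in> generated G"
  using generated_times[OF generated.const[of "-1"]] by (simp add: const_poly_uminus_1)

lemma generated_diff: "p \<in> generated G \<Longrightarrow> q \<in> generated G \<Longrightarrow> p - q \<in> generated G"
  using generated.add[OF _ generated_uminus, of p G q] by simp

lemma generated_base: "g \<in> G \<Longrightarrow> g \<in> generated G"
  using generated.mult[OF generated_1] by simp

lemma generated_sum: "(\<And>a. a \<in> A \<Longrightarrow> f a \<in> generated G) \<Longrightarrow> sum f A \<in> generated G"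
  by (induction A rule: infinite_finite_induct) (auto intro: generated_0 generated.add)

lemma generated_prod: "(\<And>a. a \<in> A \<Longrightarrow> f a \<in> generated G) \<Longrightarrow> prod f A \<in> generated G"
  by (induction A rule: infinite_finite_induct) (auto intro: generated_1 generated_times)

lemma generated_power: "p \<in> generated G \<Longrightarrow> p ^ k \<in> generated G"
  by (induction k) (auto intro: generated_1 generated_times)

lemmas generated_closed = generated_0 generated_1 generated.const generated.add generated_times
  generated_uminus generated_diff generated_sum generated_prod generated_power

lemma generated_subset_poly_ring:
  assumes "p \<in> generated G" "G \<subseteq> carrier (poly_ring n)"
  shows "p \<in> carrier (poly_ring n)"
  using assms by induction (auto intro: poly_ring_closed)

text \<open>Induction on the total degree, removing one variable from the monomial at each
  step.\<close>

lemma single_in_generated: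
  "Poly_Mapping.keys m \<subseteq> V \<Longrightarrow> Poly_Mapping.single m (c :: complex) \<in> generated (var_poly ` V)"
proof (induction "\<Sum>v\<in>Poly_Mapping.keys m. Poly_Mapping.lookup m v" arbitrary: m rule: less_induct)
  case less
  show ?case
  proof (cases "m = 0")
    case True
    then show ?thesis using generated.const[of c] by (simp add: const_poly_def)
  next
    case False
    then obtain v where v: "v \<in> Poly_Mapping.keys m" by (meson keys_eq_empty all_not_in_conv)
    define m' where "m' = m - Poly_Mapping.single v 1"
    have lk: "Poly_Mapping.lookup m' w =
        Poly_Mapping.lookup m w - (if w = v then 1 else 0)" for w
      by (simp add: m'_def lookup_minus lookup_single when_def)
    have pos: "Poly_Mapping.lookup m v > 0" using v by (simp add: in_keys_iff)
    have m: "m = m' + Poly_Mapping.single v 1"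
      using pos by (intro poly_mapping_eqI) (auto simp: lk lookup_add lookup_single when_def)
    have sub: "Poly_Mapping.keys m' \<subseteq> Poly_Mapping.keys m"
      by (auto simp: in_keys_iff lk)
    have "(\<Sum>w\<in>Poly_Mapping.keys m'. Poly_Mapping.lookup m' w) =
        (\<Sum>w\<in>Poly_Mapping.keys m. Poly_Mapping.lookup m' w)"
      by (rule sum.mono_neutral_left) (use sub in \<open>auto simp: in_keys_iff\<close>)
    also have "\<dots> < (\<Sum>w\<in>Poly_Mapping.keys m. Poly_Mapping.lookup m w)"
      by (rule sum_strict_mono_ex1) (use v pos in \<open>auto simp: lk intro!: bexI[of _ v]\<close>)
    finally have "Poly_Mapping.single m' c \<in> generated (var_poly ` V)"
      using less sub by blast
    then have "Poly_Mapping.single m' c * var_poly v \<in> generated (var_poly ` V)"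
      using v less.prems by (intro generated.mult) auto
    moreover have "Poly_Mapping.single m' c * var_poly v = Poly_Mapping.single m c"
      by (subst m) (simp add: var_poly_def mult_single)
    ultimately show ?thesis by simp
  qed
qed

lemma carrier_poly_ring_eq_generated: "carrier (poly_ring n) = generated (var_poly ` hvars n)"
proof
  show "carrier (poly_ring n) \<subseteq> generated (var_poly ` hvars n)"
  proof
    fix p assume "p \<in> carrier (poly_ring n)"
    then have *: "(\<Sum>m\<in>Poly_Mapping.keys p. Poly_Mapping.single m (Poly_Mapping.lookup p m))
        \<in> generated (var_poly ` hvars n)"
      by (intro generated_sum single_in_generated) (auto simp: carrier_poly_ring)
    show "p \<in> generated (var_poly ` hvars n)"
      by (rule ssubst[where P = "\<lambda>q. q \<in> _", OF hpoly_eq_sum_single *])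
  qed
  show "generated (var_poly ` hvars n) \<subseteq> carrier (poly_ring n)"
  proof
    fix p assume "p \<in> generated (var_poly ` hvars n)"
    then show "p \<in> carrier (poly_ring n)"
      by (rule generated_subset_poly_ring)
        (auto simp: hvars_def poly_ring_x[unfolded xvar_def] poly_ring_y[unfolded yvar_def])
  qed
qed

text \<open>An element generated by \<open>insert g G\<close> is a polynomial in \<open>g\<close>
  with coefficients generated by \<open>G\<close>, so membership in an additive set can be tested on
  single terms.\<close>

lemma generated_insert_induct:
  assumes p: "p \<in> generated (insert g G)"
    and add: "\<And>a b. a \<in> T \<Longrightarrow> b \<in> T \<Longrightarrow> a + b \<in> T"
    and pow: "\<And>q r. q \<in> generated G \<Longrightarrow> q * g ^ r \<in> T"
  shows "p \<in> T"
proof -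
  \<comment> \<open>The free factor \<open>q * g ^ r\<close> carries the induction: a further factor
    \<open>g\<close> raises \<open>r\<close>, any other generator is absorbed into
    \<open>q\<close>.\<close>
  have "p * q * g ^ r \<in> T" if "q \<in> generated G" for q r
    using p that
  proof (induction arbitrary: q r)
    case (const c)
    then show ?case by (intro pow generated_closed)
  next
    case (add p p')
    then show ?case by (simp add: distrib_right assms(2))
  next
    case (mult p g')
    show ?case
    proof (cases "g' = g")
      case True
      then show ?thesis using mult.IH[OF mult.prems, of "Suc r"] by (simp add: mult_ac)
    next
      case False
      then have "g' * q \<in> generated G"
        using mult by (intro generated_times) (auto intro: generated_base)
      from mult.IH[OF this, of r] show ?thesis by (simp add: mult_ac)
    qed
  qed
  from this[OF generated_1, of 0] show ?thesis by simp
qed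

section \<open>Standard monomials modulo the elementary symmetric polynomials\<close>

text \<open>The complete homogeneous symmetric polynomial of degree \<open>d\<close> in
  \<open>u 1\<close>, ..., \<open>u j\<close>; the recursion separates monomials by whether
  \<open>u (Suc j)\<close> occurs.\<close>

fun complete_sym :: "(nat \<Rightarrow> 'a::comm_ring_1) \<Rightarrow> nat \<Rightarrow> nat \<Rightarrow> 'a" where
  "complete_sym u 0 j = 1"
| "complete_sym u (Suc d) 0 = 0"
| "complete_sym u (Suc d) (Suc j) = complete_sym u (Suc d) j + u (Suc j) * complete_sym u d (Suc j)"

text \<open>Monomials are sorted by the exponent of the last variable. The term \<open>s = d\<close>
  is its pure power, which later allows large powers to be rewritten.\<close>

lemma complete_sym_expand:
  "complete_sym u d (Suc j) = (\<Sum>s\<le>d. u (Suc j) ^ s * complete_sym u (d - s) j)"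
proof (induction d)
  case (Suc d)
  then show ?case
    by (simp only: complete_sym.simps sum.atMost_Suc_shift sum_distrib_left)
      (simp add: mult_ac)
qed simp

lemma complete_sym_one_variable: "complete_sym u d (Suc 0) = u 1 ^ d"
  by (induction d) auto

text \<open>The generating function of the elementary symmetric polynomials with alternating signs.
  Removing or permuting variables becomes an operation on the factors of a product.\<close>

definition esym_fps :: "(nat \<Rightarrow> 'a::comm_ring_1) \<Rightarrow> nat set \<Rightarrow> 'a fps" where
  "esym_fps u A = (\<Prod>l\<in>A. 1 - fps_const (u l) * fps_X)"

text \<open>The identity E(-t) H(t) = 1: by the recursion of \<open>complete_sym\<close>, the factor
  1 - u_(m+1) t takes the series for m + 1 variables to the series for m variables.\<close>

lemma esym_fps_times_complete_sym:
  "esym_fps u {1..m} * Abs_fps (\<lambda>d. complete_sym u d m) = 1"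
proof (induction m)
  case 0
  have "complete_sym u d 0 = (if d = 0 then 1 else 0)" for d by (cases d) auto
  then show ?case by (simp add: esym_fps_def fps_eq_iff)
next
  case (Suc m)
  have "(1 - fps_const (u (Suc m)) * fps_X) * Abs_fps (\<lambda>d. complete_sym u d (Suc m)) =
      Abs_fps (\<lambda>d. complete_sym u d m)"
  proof (rule fps_ext)
    fix d
    show "fps_nth ((1 - fps_const (u (Suc m)) * fps_X) * Abs_fps (\<lambda>d. complete_sym u d (Suc m))) d =
      fps_nth (Abs_fps (\<lambda>d. complete_sym u d m)) d"
      by (cases d) (auto simp: left_diff_distrib mult.assoc)
  qed
  moreover have "esym_fps u {1..Suc m} = esym_fps u {1..m} * (1 - fps_const (u (Suc m)) * fps_X)"
    by (simp add: esym_fps_def mult.commute)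
  ultimately show ?case using Suc by (simp add: mult.assoc)
qed

lemma esym_fps_nth:
  assumes "finite A"
  shows "fps_nth (esym_fps u A) i = (-1) ^ i * (\<Sum>B | B \<subseteq> A \<and> card B = i. \<Prod>j\<in>B. u j)"
proof -
  have "esym_fps u A = (\<Prod>l\<in>A. fps_const (- u l) * fps_X + 1)"
    unfolding esym_fps_def
    by (intro prod.cong) (simp_all add: fps_const_neg[symmetric] del: fps_const_neg)
  also have "\<dots> = (\<Sum>B\<in>Pow A. (\<Prod>l\<in>B. fps_const (- u l) * fps_X) * (\<Prod>l\<in>A-B. 1))"
    by (rule prod_add[OF assms])
  also have "\<dots> = (\<Sum>B\<in>Pow A. fps_const ((-1) ^ card B * (\<Prod>l\<in>B. u l)) * fps_X ^ card B)"
  proof (rule sum.cong)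
    fix B assume "B \<in> Pow A"
    have "(\<Prod>l\<in>B. fps_const (- u l)) = fps_const (\<Prod>l\<in>B. - u l)"
      by (induction B rule: infinite_finite_induct) auto
    also have "(\<Prod>l\<in>B. - u l) = (-1) ^ card B * (\<Prod>l\<in>B. u l)"
      by (rule prod_uminus)
    finally show "(\<Prod>l\<in>B. fps_const (- u l) * fps_X) * (\<Prod>l\<in>A-B. 1) =
        fps_const ((-1) ^ card B * (\<Prod>l\<in>B. u l)) * fps_X ^ card B"
      by (simp only: prod.distrib prod_constant) simp
  qed simp
  finally have "fps_nth (esym_fps u A) i =
      (\<Sum>B\<in>Pow A. if card B = i then (-1) ^ i * (\<Prod>l\<in>B. u l) else 0)"
    by (auto simp: fps_sum_nth fps_X_power_nth intro!: sum.cong)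
  also have "\<dots> = (\<Sum>B\<in>{B. B \<subseteq> A \<and> card B = i}. (-1) ^ i * (\<Prod>l\<in>B. u l))"
    by (rule sum.mono_neutral_cong_right) (use assms in auto)
  finally show ?thesis by (simp add: sum_distrib_left)
qed

text \<open>\<open>J\<close> acts as an ideal with respect to polynomials in the \<open>u l\<close>.
  It is instantiated twice: with x_1, ..., x_n and the Hessenberg ideal, and with x_n, ..., x_2 and
  the annihilator of y_(k+1) - y_1 modulo that ideal.\<close>

locale coinvariant =
  fixes u :: "nat \<Rightarrow> hpoly" and m :: nat and J :: "hpoly set"
  assumes J_0: "0 \<in> J"
    and J_add: "\<And>a b. a \<in> J \<Longrightarrow> b \<in> J \<Longrightarrow> a + b \<in> J"
    and J_mult: "\<And>a b. a \<in> J \<Longrightarrow> b \<in> generated (u ` {1..m}) \<Longrightarrow> a * b \<in> J"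
    and J_esym: "\<And>i. i \<ge> 1 \<Longrightarrow> fps_nth (esym_fps u {1..m}) i \<in> J"
begin

lemma J_uminus: "a \<in> J \<Longrightarrow> - a \<in> J"
  using J_mult[of a "const_poly (-1)", OF _ generated.const] by (simp add: const_poly_uminus_1)

lemma J_sum: "(\<And>a. a \<in> A \<Longrightarrow> f a \<in> J) \<Longrightarrow> sum f A \<in> J"
  by (induction A rule: infinite_finite_induct) (auto intro: J_0 J_add)

lemma complete_sym_generated: "complete_sym u d j \<in> generated (u ` {1..j})"
proof (induction u d j rule: complete_sym.induct)
  case (3 u d j)
  have "complete_sym u (Suc d) j \<in> generated (u ` {1..Suc j})"
    by (rule generated_mono[OF 3(1)]) auto
  then show ?case
    using 3(2) unfolding complete_sym.simps
    by (intro generated.add generated_times) (auto intro: generated_base)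
qed (auto intro: generated_closed)

text \<open>Descending induction on \<open>j\<close>. For \<open>j = m\<close> the product identity
  expresses h_d through elementary symmetric polynomials of positive degree; dropping a variable
  uses h_d(u_1..u_j) = h_d(u_1..u_(j+1)) - u_(j+1) h_(d-1)(u_1..u_(j+1)).\<close>

lemma complete_sym_in_J: "d \<ge> 1 \<Longrightarrow> j \<le> m \<Longrightarrow> d + j > m \<Longrightarrow> complete_sym u d j \<in> J"
proof (induction "m - j" arbitrary: d j)
  case 0
  then have j: "j = m" by simp
  have "(\<Sum>i=0..d. fps_nth (esym_fps u {1..m}) i * complete_sym u (d - i) m) = 0"
    using arg_cong[OF esym_fps_times_complete_sym[of u m], of "\<lambda>f. fps_nth f d"] \<open>d \<ge> 1\<close>
    by (simp add: fps_mult_nth)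
  then have "fps_nth (esym_fps u {1..m}) 0 * complete_sym u d m
      + (\<Sum>i=1..d. fps_nth (esym_fps u {1..m}) i * complete_sym u (d - i) m) = 0"
    by (simp add: sum.atLeast_Suc_atMost)
  moreover have "fps_nth (esym_fps u {1..m}) 0 = 1"
    by (simp add: esym_fps_nth card_eq_0_iff finite_subset cong: conj_cong)
  ultimately have "complete_sym u d m = - (\<Sum>i=1..d. fps_nth (esym_fps u {1..m}) i * complete_sym u (d - i) m)"
    by (simp add: eq_neg_iff_add_eq_0)
  also have "\<dots> \<in> J"
    by (intro J_uminus J_sum J_mult J_esym complete_sym_generated) auto
  finally show ?case by (simp add: j)
next
  case (Suc k)
  then have IH: "complete_sym u e (Suc j) \<in> J" if "e \<ge> 1" "e + Suc j > m" for e
    using that by simp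
  \<comment> \<open>Here j < m and d + j > m force d \<ge> 2, so \<open>d'\<close> is positive, as
    the induction hypothesis requires.\<close>
  obtain d' where d: "d = Suc d'" using Suc.prems by (cases d) auto
  have "complete_sym u d j = complete_sym u d (Suc j) + - (complete_sym u d' (Suc j) * u (Suc j))"
    by (simp add: d)
  moreover have "Suc j \<le> m" using Suc by simp
  then have "complete_sym u d' (Suc j) * u (Suc j) \<in> J"
    using Suc d by (intro J_mult IH) (auto intro: generated_base)
  ultimately show ?case
    using IH[of d] Suc.prems J_add[OF _ J_uminus] by auto
qed

text \<open>Since h_(m-j)(u_1..u_(j+1)) lies in \<open>J\<close>, the power u_(j+1)^(m-j) reduces to
  lower powers with coefficients in fewer variables. \<open>T\<close> is merely additive because it
  will be the preimage of a linear span under multiplication by a fixed element.\<close>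

theorem standard_monomials_span:
  assumes T_add: "\<And>a b. a \<in> T \<Longrightarrow> b \<in> T \<Longrightarrow> a + b \<in> T"
    and T_J: "J \<subseteq> T"
    and T_std: "\<And>c i. (\<And>l. l \<in> {1..m} \<Longrightarrow> i l \<le> m - l) \<Longrightarrow>
      const_poly c * (\<Prod>l=1..m. u l ^ i l) \<in> T"
    and p: "p \<in> generated (u ` {1..m})"
  shows "p \<in> T"
proof -
  have T_sum: "sum f A \<in> T" if "\<And>a. a \<in> A \<Longrightarrow> f a \<in> T" for f and A :: "nat set"
    using that by (induction A rule: infinite_finite_induct) (use J_0 T_J in \<open>auto intro: T_add\<close>)
  \<comment> \<open>Induction on the number of variables still unrestricted; those beyond
    \<open>j\<close> already have standard exponents.\<close>
  have "p * (\<Prod>l=Suc j..m. u l ^ i l) \<in> T"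
    if "p \<in> generated (u ` {1..j})" "j \<le> m" "\<And>l. l \<in> {Suc j..m} \<Longrightarrow> i l \<le> m - l" for p j i
    using that
  proof (induction j arbitrary: p i)
    case 0
    from \<open>p \<in> generated (u ` {1..0})\<close> have "\<exists>c. p = const_poly c"
      by induction (auto simp: const_poly_add[symmetric])
    then show ?case using 0 T_std[of i] by auto
  next
    case (Suc j)
    define t where "t = (\<Prod>l=Suc (Suc j)..m. u l ^ i l)"
    have t: "t \<in> generated (u ` {1..m})"
      unfolding t_def by (intro generated_closed generated_base) auto
    have split: "(\<Prod>l=Suc j..m. u l ^ k l) = u (Suc j) ^ k (Suc j) * (\<Prod>l=Suc (Suc j)..m. u l ^ k l)" for k
      using Suc.prems(2) by (rule prod.atLeast_Suc_atMost)
    have main: "q * u (Suc j) ^ r * t \<in> T" if "q \<in> generated (u ` {1..j})" for q r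
      using that
    proof (induction r arbitrary: q rule: less_induct)
      case (less r)
      have qm: "q \<in> generated (u ` {1..m})"
        using less.prems(1) Suc.prems(2) by (auto elim!: generated_mono)
      show ?case
      proof (cases "r \<le> m - Suc j")
        case True
        have "q * (\<Prod>l=Suc j..m. u l ^ (i(Suc j := r)) l) \<in> T"
          by (rule Suc.IH) (use Suc.prems less.prems True in auto)
        moreover have "(\<Prod>l=Suc j..m. u l ^ (i(Suc j := r)) l) = u (Suc j) ^ r * t"
          unfolding split t_def by (auto intro!: prod.cong)
        ultimately show ?thesis by (simp add: mult.assoc)
      next
        case False
        \<comment> \<open>The first exponent of \<open>u (Suc j)\<close> that is not standard, and
          also the least degree in which \<open>complete_sym_in_J\<close> applies to
          \<open>Suc j\<close> variables.\<close>
        define e where "e = m - j"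
        define r' where "r' = r - e"
        have e: "e \<ge> 1" and r: "r = r' + e" using Suc.prems False by (auto simp: e_def r'_def)
        have "complete_sym u e (Suc j) =
            (\<Sum>s<e. u (Suc j) ^ s * complete_sym u (e - s) j) + u (Suc j) ^ e"
          unfolding complete_sym_expand by (simp add: lessThan_Suc_atMost[symmetric])
        then have "u (Suc j) ^ e = complete_sym u e (Suc j) +
            - (\<Sum>s<e. u (Suc j) ^ s * complete_sym u (e - s) j)"
          by simp
        then have "q * u (Suc j) ^ r * t = complete_sym u e (Suc j) * (q * u (Suc j) ^ r' * t) +
            (\<Sum>s<e. (- (q * complete_sym u (e - s) j)) * u (Suc j) ^ (r' + s) * t)"
          by (simp only: r power_add)
            (simp add: algebra_simps sum_distrib_left sum_distrib_right sum_negf)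
        moreover have "complete_sym u e (Suc j) * (q * u (Suc j) ^ r' * t) \<in> J"
          using Suc.prems(2) e qm t
          by (intro J_mult complete_sym_in_J generated_times generated_power)
            (auto simp: e_def intro: generated_base)
        moreover have "(\<Sum>s<e. (- (q * complete_sym u (e - s) j)) * u (Suc j) ^ (r' + s) * t) \<in> T"
          by (intro T_sum less.IH generated_closed less.prems complete_sym_generated) (auto simp: r)
        ultimately show ?thesis using T_J by (auto intro: T_add)
      qed
    qed
    have ins: "u ` {1..Suc j} = insert (u (Suc j)) (u ` {1..j})"
      by (simp add: atLeastAtMostSuc_conv)
    have "p \<in> generated (insert (u (Suc j)) (u ` {1..j}))"
      using Suc.prems(1) unfolding ins .
    then have "p \<in> {p. p * t \<in> T}"
      by (rule generated_insert_induct) (use main in \<open>auto simp: distrib_right T_add\<close>)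
    then show ?case by (simp add: t_def)
  qed
  from this[of p m i for i] p show ?thesis by simp
qed

end

section \<open>The spanning set\<close>

text \<open>Divisibility with control of the cofactor: it is again a polynomial in the variables of
  \<open>B\<close>, so that it may later multiply elements of the ideal.\<close>

lemma prod_power_factor:
  assumes "finite B" "A \<subseteq> B" "\<And>l. l \<in> A \<Longrightarrow> i l \<ge> 1"
  shows "\<exists>w\<in>generated (u ` B). (\<Prod>l\<in>B. u l ^ i l) = (\<Prod>l\<in>A. u l) * w"
proof
  let ?w = "\<Prod>l\<in>B. u l ^ (if l \<in> A then i l - 1 else i l)"
  show "?w \<in> generated (u ` B)"
    by (intro generated_prod generated_power generated_base) auto
  have "(\<Prod>l\<in>A. u l) = (\<Prod>l\<in>B. u l ^ (if l \<in> A then 1 else 0))"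
    by (rule prod.mono_neutral_cong_left) (use assms in auto)
  then have "(\<Prod>l\<in>A. u l) * ?w =
      (\<Prod>l\<in>B. u l ^ ((if l \<in> A then 1 else 0) + (if l \<in> A then i l - 1 else i l)))"
    by (simp add: prod.distrib power_add)
  also have "\<dots> = (\<Prod>l\<in>B. u l ^ i l)"
    by (intro prod.cong arg_cong[where f = "power _"] refl) (use assms(3) in force)
  finally show "(\<Prod>l\<in>B. u l ^ i l) = (\<Prod>l\<in>A. u l) * ?w" by simp
qed

text \<open>Setting \<open>v l\<close> to 0 and every other variable to 1 kills the product but
  sends the monomial to 1.\<close>

lemma prod_var_not_dvd:
  assumes "finite A" "finite B" "l \<in> A" "i l = 0" "inj_on v (insert l B)"
  shows "\<not> (\<Prod>j\<in>A. var_poly (v j)) dvd (\<Prod>j\<in>B. var_poly (v j) ^ i j)"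
proof
  assume "(\<Prod>j\<in>A. var_poly (v j)) dvd (\<Prod>j\<in>B. var_poly (v j) ^ i j)"
  then obtain q where q: "(\<Prod>j\<in>B. var_poly (v j) ^ i j) = (\<Prod>j\<in>A. var_poly (v j)) * q"
    by (auto elim: dvdE)
  define f :: "hvar \<Rightarrow> complex poly" where "f = (\<lambda>w. if w = v l then 0 else 1)"
  have "(\<Prod>j\<in>B. f (v j) ^ i j) = (\<Prod>j\<in>A. f (v j)) * eval_hpoly f q"
    using arg_cong[OF q, of "eval_hpoly f"] by (simp add: eval_hpoly_simps)
  moreover have "(\<Prod>j\<in>A. f (v j)) = 0"
    using assms by (auto simp: f_def)
  moreover have "(\<Prod>j\<in>B. f (v j) ^ i j) = 1"
    by (rule prod.neutral) (use assms in \<open>auto simp: f_def inj_on_def\<close>)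
  ultimately show False by simp
qed

text \<open>Setting \<open>a\<close> to 0 leaves the first summand. With a = x_1 this compares D
  with the product of the -x_l.\<close>

lemma prod_diff_split:
  assumes "a \<in> generated G" "\<And>l. l \<in> A \<Longrightarrow> f l \<in> generated G"
  shows "\<exists>q\<in>generated G. (\<Prod>l\<in>A. a - f l) = (\<Prod>l\<in>A. - f l) + a * q"
  using assms(2)
proof (induction A rule: infinite_finite_induct)
  case (insert l A)
  then obtain q where q: "q \<in> generated G" "(\<Prod>l\<in>A. a - f l) = (\<Prod>l\<in>A. - f l) + a * q" by auto
  show ?case
  proof
    show "(\<Prod>l\<in>A. - f l) + a * q - f l * q \<in> generated G"
      by (intro generated.add generated_times generated_diff generated_prod generated_uminus)
        (use insert.prems assms(1) q in auto)
    show "(\<Prod>l\<in>insert l A. a - f l) =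
        (\<Prod>l\<in>insert l A. - f l) + a * ((\<Prod>l\<in>A. - f l) + a * q - f l * q)"
      using insert.hyps q(2) by (simp add: algebra_simps)
  qed
qed (auto intro!: bexI[of _ 0] generated_0)

section \<open>Counting the exponent vectors\<close>

definition exponents :: "nat \<Rightarrow> nat \<Rightarrow> (nat \<Rightarrow> nat) set" where
  "exponents m r = {i \<in> (\<Pi>\<^sub>E l\<in>{1..m}. {0..m - l}). \<exists>l\<in>{1..r}. i l = 0}"

text \<open>The left side counts the standard exponent vectors whose first \<open>r\<close> entries
  are positive. Both sides vanish for \<open>r = m\<close>.\<close>

lemma prod_diff_fact:
  assumes "r \<le> m" "m \<ge> 1"
  shows "(\<Prod>l=1..r. m - l) * fact (m - r) = fact (m - 1) * (m - r)"
  using assms(1)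
proof (induction r)
  case 0
  then show ?case using assms(2) by (cases m) auto
next
  case (Suc r)
  then have "m - r = Suc (m - Suc r)" by simp
  then have "fact (m - r) = (m - r) * (fact (m - Suc r) :: nat)" by (metis fact_Suc of_nat_id)
  then have "((\<Prod>l=1..r. m - l) * fact (m - Suc r)) * (m - r) = fact (m - 1) * (m - r)"
    using Suc by (simp add: mult_ac)
  then have "(\<Prod>l=1..r. m - l) * fact (m - Suc r) = fact (m - 1)"
    using Suc.prems by simp
  then show ?case by (simp add: mult_ac)
qed

lemma prod_Suc_diff_fact:
  assumes "r \<le> m" shows "(\<Prod>l=Suc r..m. Suc (m - l)) = fact (m - r)"
proof -
  have "(\<Prod>l=Suc r..m. Suc (m - l)) = (\<Prod>j=1..m - r. j)"
    by (rule prod.reindex_bij_witness[of _ "\<lambda>j. Suc m - j" "\<lambda>l. Suc m - l"]) (use assms in auto)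
  then show ?thesis by (simp add: fact_prod)
qed

lemma finite_exponents: "finite (exponents m r)"
  unfolding exponents_def by (rule finite_subset[OF Collect_subset]) (auto intro: finite_PiE)

text \<open>Complementary counting: from the m! standard exponent vectors those without a zero among
  the first \<open>r\<close> entries are removed. The pairs used for (m, r) are (n, h) and (n - 1, n
  - h).\<close>

lemma card_exponents:
  assumes "r \<le> m" "m \<ge> 1"
  shows "card (exponents m r) = fact m - fact (m - 1) * (m - r)"
proof -
  let ?U = "\<Pi>\<^sub>E l\<in>{1..m}. {0..m - l}"
  let ?D = "\<Pi>\<^sub>E l\<in>{1..m}. if l \<le> r then {1..m - l} else {0..m - l}"
  have "exponents m r = ?U - ?D"
  proof (intro equalityI subsetI)
    fix i assume "i \<in> exponents m r"
    then obtain l where l: "i \<in> ?U" "l \<in> {1..r}" "i l = 0" by (auto simp: exponents_def)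
    then have "i \<notin> ?D" using assms PiE_mem[of i "{1..m}" "\<lambda>l. if l \<le> r then {1..m - l} else {0..m - l}" l] by auto
    with l show "i \<in> ?U - ?D" by blast
  next
    fix i assume i: "i \<in> ?U - ?D"
    show "i \<in> exponents m r"
    proof (rule ccontr)
      assume "i \<notin> exponents m r"
      with i have "\<And>l. l \<in> {1..r} \<Longrightarrow> i l \<noteq> 0" by (auto simp: exponents_def)
      moreover have "i \<in> extensional {1..m}" "\<And>l. l \<in> {1..m} \<Longrightarrow> i l \<le> m - l"
        using i by (auto simp: PiE_def Pi_def)
      ultimately have "i \<in> ?D" by (auto simp: PiE_def Pi_def Suc_le_eq)
      with i show False by simp
    qed
  qed
  moreover have "?D \<subseteq> ?U" by (rule PiE_mono) auto
  moreover have "finite ?D" by (rule finite_PiE) auto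
  moreover have "card ?U = fact m"
    using prod_Suc_diff_fact[of 0 m] by (simp add: card_PiE)
  moreover have "card ?D = fact (m - 1) * (m - r)"
  proof -
    have "card ?D = (\<Prod>l=1..m. if l \<le> r then m - l else Suc (m - l))"
      by (subst card_PiE) (auto intro!: prod.cong)
    also have "\<dots> = (\<Prod>l\<in>{1..r} \<union> {Suc r..m}. if l \<le> r then m - l else Suc (m - l))"
      using assms by (intro prod.cong) auto
    also have "(\<Prod>l\<in>{1..r} \<union> {Suc r..m}. if l \<le> r then m - l else Suc (m - l)) =
        (\<Prod>l=1..r. if l \<le> r then m - l else Suc (m - l)) *
        (\<Prod>l=Suc r..m. if l \<le> r then m - l else Suc (m - l))"
      by (rule prod.union_disjoint) auto
    also have "\<dots> = (\<Prod>l=1..r. m - l) * (\<Prod>l=Suc r..m. Suc (m - l))"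
      by (intro arg_cong2[where f = "(*)"] prod.cong) auto
    finally show ?thesis by (simp only: prod_Suc_diff_fact prod_diff_fact assms)
  qed
  ultimately show ?thesis by (simp add: card_Diff_subset)
qed

section \<open>Relations in the Hessenberg quotient\<close>

locale hessenberg =
  fixes n h :: nat
  assumes n2: "n \<ge> 2" and h1: "1 \<le> h" and hn: "h \<le> n"
begin

abbreviation "C \<equiv> carrier (poly_ring n)"
abbreviation "I \<equiv> hess_ideal n h"
abbreviation "X \<equiv> generated (xvar ` {1..n})"
abbreviation "S \<equiv> x_elements n h \<union> y_elements n h"

text \<open>The reversal turns the exponent bounds of the second family into the standard ones for
  the variables \<open>xrev 1\<close>, ..., \<open>xrev (n - 1)\<close>.\<close>

definition xrev :: "nat \<Rightarrow> hpoly" where "xrev j = xvar (n + 1 - j)"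

definition dfactor :: hpoly where "dfactor = (\<Prod>l=2..h. xvar 1 - xvar l)"

lemma I_0: "0 \<in> I"
  using additive_subgroup.zero_closed[OF ideal.axioms(1)[OF ideal_hess_ideal[OF h1 hn]]] by simp

lemma I_add: "a \<in> I \<Longrightarrow> b \<in> I \<Longrightarrow> a + b \<in> I"
  using additive_subgroup.a_closed[OF ideal.axioms(1)[OF ideal_hess_ideal[OF h1 hn]], of a b] by simp

lemma I_mult: "a \<in> I \<Longrightarrow> b \<in> C \<Longrightarrow> a * b \<in> I"
  using ideal.I_r_closed[OF ideal_hess_ideal[OF h1 hn], of a b] by simp

lemma I_mult_left: "a \<in> I \<Longrightarrow> b \<in> C \<Longrightarrow> b * a \<in> I"
  using I_mult by (simp add: mult.commute)

lemma I_uminus: "a \<in> I \<Longrightarrow> - a \<in> I"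
  using I_mult[of a "const_poly (-1)"] by (simp add: poly_ring_const const_poly_uminus_1[symmetric])
    (simp add: const_poly_uminus_1)

lemma I_diff: "a \<in> I \<Longrightarrow> b \<in> I \<Longrightarrow> a - b \<in> I"
  using I_add[OF _ I_uminus, of a b] by simp

lemma I_sum: "(\<And>a. a \<in> A \<Longrightarrow> f a \<in> I) \<Longrightarrow> sum f A \<in> I"
  by (induction A rule: infinite_finite_induct) (auto intro: I_0 I_add)

lemma rel_in_I: "r \<in> hess_relations n h \<Longrightarrow> r \<in> I"
  unfolding hess_ideal_def
  using ring.genideal_self[OF cring.axioms(1)[OF cring_poly_ring] hess_relations_carrier[OF h1 hn]]
  by blast

lemma X_sub: "p \<in> X \<Longrightarrow> p \<in> C"
  by (rule generated_subset_poly_ring) (auto intro: poly_ring_x)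

lemma x_in_X: "l \<in> {1..n} \<Longrightarrow> xvar l \<in> X"
  by (auto intro: generated_base)

lemma dfactor_in_X: "dfactor \<in> X"
  unfolding dfactor_def using hn h1 by (intro generated_prod generated_diff x_in_X) auto

lemma yy_in_I: "k \<in> {1..n} \<Longrightarrow> k' \<in> {1..n} \<Longrightarrow> k \<noteq> k' \<Longrightarrow> yvar k * yvar k' \<in> I"
  by (rule rel_in_I) (auto simp: hess_relations_def)

lemma x1y_in_I: "k \<in> {1..n} \<Longrightarrow> xvar 1 * yvar k \<in> I"
  by (rule rel_in_I) (auto simp: hess_relations_def)

lemma sum_y_in_I: "(\<Sum>k=1..n. yvar k) - dfactor \<in> I"
  by (rule rel_in_I) (auto simp: hess_relations_def dfactor_def)

lemma py_in_I: "k \<in> {1..n} \<Longrightarrow> (\<Prod>l=h+1..n. - xvar l) * yvar k - (\<Prod>l=2..n. - xvar l) \<in> I"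
  by (rule rel_in_I) (auto simp: hess_relations_def)

lemma elem_sym_in_I: "i \<in> {1..n} \<Longrightarrow> elem_sym n i \<in> I"
  by (rule rel_in_I) (auto simp: hess_relations_def)

text \<open>The relation for the sum of the y_k is multiplied by x_1, which kills every y_k.\<close>

lemma x1_dfactor_in_I: "xvar 1 * dfactor \<in> I"
proof -
  have "xvar 1 * dfactor = (\<Sum>k=1..n. xvar 1 * yvar k) - ((\<Sum>k=1..n. yvar k) - dfactor) * xvar 1"
    by (simp add: algebra_simps sum_distrib_left)
  also have "\<dots> \<in> I"
    using n2 by (intro I_diff I_sum x1y_in_I I_mult sum_y_in_I poly_ring_x) auto
  finally show ?thesis .
qed

text \<open>The relation for the sum of the y_j is multiplied by y_k; the mixed products
  vanish.\<close>

lemma y_squared_in_I: assumes "k \<in> {1..n}" shows "yvar k * yvar k - dfactor * yvar k \<in> I"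
proof -
  have "(\<Sum>j\<in>{1..n}. yvar j) = yvar k + (\<Sum>j\<in>{1..n}-{k}. yvar j)"
    using assms by (simp add: sum.remove)
  then have "yvar k * yvar k - dfactor * yvar k = ((\<Sum>k=1..n. yvar k) - dfactor) * yvar k
      - (\<Sum>j\<in>{1..n}-{k}. yvar j * yvar k)"
    by (simp add: algebra_simps sum_distrib_left)
  also have "\<dots> \<in> I"
    using assms by (intro I_diff I_sum yy_in_I I_mult sum_y_in_I poly_ring_y) auto
  finally show ?thesis .
qed

section \<open>The candidate basis and its size\<close>

lemma prod_xrev: "(\<Prod>l=h+1..n. f (xvar l)) = (\<Prod>j=1..n - h. f (xrev j))"
  unfolding xrev_def
  by (rule prod.reindex_bij_witness[of _ "\<lambda>j. n + 1 - j" "\<lambda>l. n + 1 - l"]) auto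

lemma x_elementsI:
  assumes "\<And>l. l \<in> {1..n} \<Longrightarrow> i l \<le> n - l" "l \<in> {1..h}" "i l = 0"
  shows "(\<Prod>l=1..n. xvar l ^ i l) \<in> x_elements n h"
proof -
  have "\<not> (\<Prod>l=1..h. xvar l) dvd (\<Prod>l=1..n. xvar l ^ i l)"
    unfolding xvar_def by (rule prod_var_not_dvd[of _ _ l]) (use assms in \<open>auto simp: inj_on_def\<close>)
  then show ?thesis using assms(1) unfolding x_elements_def by blast
qed

lemma y_elementsI:
  assumes "\<And>l. l \<in> {1..n - 1} \<Longrightarrow> e l \<le> n - 1 - l" "l \<in> {1..n - h}" "e l = 0" "k \<in> {1..n - 1}"
  shows "(\<Prod>l=1..n - 1. xrev l ^ e l) * (yvar (k + 1) - yvar 1) \<in> y_elements n h"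
proof -
  have "\<not> (\<Prod>l=1..n-h. xrev l) dvd (\<Prod>l=1..n - 1. xrev l ^ e l)"
    unfolding xvar_def xrev_def
    by (rule prod_var_not_dvd[of _ _ l]) (use assms h1 in \<open>auto simp: inj_on_def\<close>)
  then have "\<not> (\<Prod>l=h+1..n. xvar l) dvd (\<Prod>l=1..n - 1. xrev l ^ e l)"
    using prod_xrev[of "\<lambda>x. x"] by simp
  then show ?thesis using assms(1,4) unfolding y_elements_def xrev_def by blast
qed

lemma x_elements_subset: "x_elements n h \<subseteq> (\<lambda>i. \<Prod>l=1..n. xvar l ^ i l) ` exponents n h"
proof
  fix s assume "s \<in> x_elements n h"
  then obtain i where i: "s = (\<Prod>l=1..n. xvar l ^ i l)" "\<And>l. l \<in> {1..n} \<Longrightarrow> i l \<le> n - l"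
      "\<not> (\<Prod>l=1..h. xvar l) dvd s"
    unfolding x_elements_def by blast
  have "\<exists>l\<in>{1..h}. i l = 0"
  proof (rule ccontr)
    assume "\<not> ?thesis"
    then have "\<exists>w\<in>X. (\<Prod>l=1..n. xvar l ^ i l) = (\<Prod>l=1..h. xvar l) * w"
      using hn by (intro prod_power_factor) (auto simp: Suc_le_eq)
    with i show False by auto
  qed
  then have "restrict i {1..n} \<in> exponents n h"
    using i(2) hn by (auto simp: exponents_def)
  moreover have "s = (\<Prod>l=1..n. xvar l ^ restrict i {1..n} l)" by (simp add: i(1))
  ultimately show "s \<in> (\<lambda>i. \<Prod>l=1..n. xvar l ^ i l) ` exponents n h" by blast
qed

lemma y_elements_subset: "y_elements n h \<subseteq>
    (\<lambda>(e, k). (\<Prod>l=1..n - 1. xrev l ^ e l) * (yvar (k + 1) - yvar 1)) `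
      (exponents (n - 1) (n - h) \<times> {1..n - 1})"
proof
  fix s assume "s \<in> y_elements n h"
  then obtain e k where e: "s = (\<Prod>l=1..n - 1. xrev l ^ e l) * (yvar (k + 1) - yvar 1)"
      "\<And>l. l \<in> {1..n - 1} \<Longrightarrow> e l \<le> n - 1 - l" "k \<in> {1..n - 1}"
      "\<not> (\<Prod>l=h+1..n. xvar l) dvd (\<Prod>l=1..n - 1. xrev l ^ e l)"
    unfolding y_elements_def xrev_def by blast
  have "\<exists>l\<in>{1..n - h}. e l = 0"
  proof (rule ccontr)
    assume "\<not> ?thesis"
    then have "\<exists>w\<in>generated (xrev ` {1..n - 1}).
        (\<Prod>l=1..n - 1. xrev l ^ e l) = (\<Prod>l=1..n - h. xrev l) * w"
      using h1 by (intro prod_power_factor) (auto simp: Suc_le_eq)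
    with e(4) prod_xrev[of "\<lambda>x. x"] show False by auto
  qed
  then have "restrict e {1..n - 1} \<in> exponents (n - 1) (n - h)"
    using e(2) h1 by (auto simp: exponents_def)
  moreover have "s = (\<lambda>(e, k). (\<Prod>l=1..n - 1. xrev l ^ e l) * (yvar (k + 1) - yvar 1))
      (restrict e {1..n - 1}, k)"
    by (simp add: e(1))
  ultimately show "s \<in> (\<lambda>(e, k). (\<Prod>l=1..n - 1. xrev l ^ e l) * (yvar (k + 1) - yvar 1)) `
      (exponents (n - 1) (n - h) \<times> {1..n - 1})"
    using e(3) by blast
qed

lemma finite_S: "finite S"
  using finite_subset[OF x_elements_subset] finite_subset[OF y_elements_subset]
  by (auto simp: finite_exponents)

text \<open>The first family has at most n! - (n-1)! (n-h) elements. Because (n-2)! (n-1) = (n-1)!,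
  the second has at most (n-1)! ((n-1) - (h-1)), which is exactly the deficit.\<close>

lemma card_S: "card S \<le> fact n"
proof -
  obtain k where "n = 2 + k" using n2 le_Suc_ex by blast
  then have n: "n = Suc (Suc k)" by simp
  obtain a where h: "h = Suc a" using h1 by (cases h) auto
  have "card S \<le> card (x_elements n h) + card (y_elements n h)" by (rule card_Un_le)
  also have "card (x_elements n h) \<le> card (exponents n h)"
    by (rule surj_card_le[OF finite_exponents x_elements_subset])
  also have "card (y_elements n h) \<le> card (exponents (n - 1) (n - h) \<times> {1..n - 1})"
    by (rule surj_card_le[OF _ y_elements_subset]) (simp add: finite_exponents)
  also have "card (exponents n h) + card (exponents (n - 1) (n - h) \<times> {1..n - 1}) =
      (fact n - fact (n - 1) * (n - h)) + (fact (n - 1) - fact (n - 2) * (h - 1)) * (n - 1)"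
    using n2 h1 hn by (simp add: card_exponents card_cartesian_product numeral_2_eq_2)
  also have "\<dots> = fact n"
  proof -
    define F :: nat where "F = fact (n - 1)"
    have F: "fact n = n * F" "fact (n - 2) * (n - 1) = F"
      by (simp_all add: n F_def numeral_2_eq_2)
    have "(F - fact (n - 2) * (h - 1)) * (n - 1) = F * (n - 1) - F * (h - 1)"
      unfolding diff_mult_distrib[of F] by (subst (3) F(2)[symmetric]) (simp only: mult_ac)
    also have "\<dots> = F * (n - h)"
      using h1 hn by (simp add: diff_mult_distrib2[symmetric])
    finally show ?thesis
      using hn by (simp add: F(1) F_def[symmetric] mult.commute[of n] del: One_nat_def)
  qed
  finally show ?thesis by simp
qed

section \<open>Spanning of the quotient\<close>

definition T :: "hpoly set" where
  "T = {p. \<exists>c. p - (\<Sum>s\<in>S. const_poly (c s) * s) \<in> I}"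

lemma T_add: assumes "a \<in> T" "b \<in> T" shows "a + b \<in> T"
proof -
  obtain c d where "a - (\<Sum>s\<in>S. const_poly (c s) * s) \<in> I" "b - (\<Sum>s\<in>S. const_poly (d s) * s) \<in> I"
    using assms by (auto simp: T_def)
  then have "a - (\<Sum>s\<in>S. const_poly (c s) * s) + (b - (\<Sum>s\<in>S. const_poly (d s) * s)) \<in> I"
    by (rule I_add)
  also have "a - (\<Sum>s\<in>S. const_poly (c s) * s) + (b - (\<Sum>s\<in>S. const_poly (d s) * s)) =
      a + b - (\<Sum>s\<in>S. const_poly (c s + d s) * s)"
    by (simp add: const_poly_add distrib_right sum.distrib)
  finally show ?thesis by (auto simp: T_def)
qed

lemma T_I: "a \<in> I \<Longrightarrow> a \<in> T"
  by (auto simp: T_def intro!: exI[of _ "\<lambda>_. 0"])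

lemma T_S: assumes "s \<in> S" shows "const_poly c * s \<in> T"
proof -
  have "(\<Sum>t\<in>S. const_poly (if t = s then c else 0) * t) = (\<Sum>t\<in>S. if t = s then const_poly c * s else 0)"
    by (rule sum.cong) auto
  also have "\<dots> = const_poly c * s"
    using assms finite_S by simp
  finally show ?thesis
    by (auto simp: T_def I_0 intro!: exI[of _ "\<lambda>t. if t = s then c else 0"])
qed

lemma T_sum: "(\<And>a. a \<in> A \<Longrightarrow> f a \<in> T) \<Longrightarrow> sum f A \<in> T"
  by (induction A rule: infinite_finite_induct) (auto intro: T_I I_0 T_add)

lemma esym_in_I: assumes "i \<ge> 1" shows "fps_nth (esym_fps xvar {1..n}) i \<in> I"
proof (cases "i \<le> n")
  case True
  have "(-1) ^ i * elem_sym n i \<in> I"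
    by (intro I_mult_left elem_sym_in_I poly_ring_closed) (use assms True in auto)
  then show ?thesis by (simp add: esym_fps_nth elem_sym_def)
next
  case False
  have "{B. B \<subseteq> {1..n} \<and> card B = i} = {}"
    using False card_mono[of "{1..n}"] by auto
  then show ?thesis by (simp only: esym_fps_nth finite_atLeastAtMost) (simp add: I_0)
qed

sublocale x: coinvariant xvar n I
  by unfold_locales (fact I_0, fact I_add, fact I_mult[OF _ X_sub], fact esym_in_I)

text \<open>In one variable the complete symmetric polynomial of degree \<open>k\<close> is x_1^k.
  This starts the descending induction on the power of x_1.\<close>

lemma x1_power_in_I: "k \<ge> n \<Longrightarrow> xvar 1 ^ k \<in> I"
  using x.complete_sym_in_J[of k 1] n2 by (simp add: complete_sym_one_variable)

text \<open>Modulo \<^term>\<open>xvar 1 * dfactor\<close>, a standard monomial divisible by $x_1 \cdots x_h$ becomes a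
  multiple of a higher power of $x_1$; hence the descending induction on that power.\<close>

lemma x1_power_mult_in_T: "p \<in> X \<Longrightarrow> xvar 1 ^ k * p \<in> T"
proof (induction "n - k" arbitrary: k p)
  case 0
  then show ?case by (intro T_I I_mult x1_power_in_I X_sub) auto
next
  case (Suc j)
  then have k: "k < n" by simp
  have IH: "xvar 1 ^ Suc k * q \<in> T" if "q \<in> X" for q
    by (rule Suc.hyps(1)) (use Suc.hyps(2) that in auto)
  have "p \<in> {p. xvar 1 ^ k * p \<in> T}"
  proof (rule x.standard_monomials_span)
    show "I \<subseteq> {p. xvar 1 ^ k * p \<in> T}"
      using n2 by (auto intro!: T_I I_mult_left poly_ring_closed)
    fix c and i :: "nat \<Rightarrow> nat" assume i: "\<And>l. l \<in> {1..n} \<Longrightarrow> i l \<le> n - l"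
    define t where "t = (\<Prod>l=2..n. xvar l ^ i l)"
    have split: "(\<Prod>l=1..n. xvar l ^ e l) = xvar 1 ^ e 1 * (\<Prod>l=2..n. xvar l ^ e l)" for e :: "nat \<Rightarrow> nat"
      using n2 by (simp add: prod.atLeast_Suc_atMost numeral_2_eq_2)
    have t: "t \<in> X" unfolding t_def by (intro generated_prod generated_power x_in_X) auto
    have x1: "xvar 1 \<in> X" using n2 by (intro x_in_X) auto
    have "xvar 1 ^ k * (const_poly c * (\<Prod>l=1..n. xvar l ^ i l)) \<in> T"
    proof (cases "i 1")
      case (Suc i1)
      have "xvar 1 ^ k * (const_poly c * (\<Prod>l=1..n. xvar l ^ i l)) =
          xvar 1 ^ Suc k * (const_poly c * xvar 1 ^ i1 * t)"
        unfolding split Suc t_def by (simp add: mult_ac)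
      then show ?thesis
        using IH[of "const_poly c * xvar 1 ^ i1 * t"] t x1 by (auto intro!: generated_closed)
    next
      case 0
      \<comment> \<open>As x_1 is absent from the monomial, the outer factor x_1^k can be moved into
        the exponent vector; \<open>k < n\<close> keeps it standard.\<close>
      define e where "e = i(1 := k)"
      have e: "(\<Prod>l=1..n. xvar l ^ e l) = xvar 1 ^ k * t"
        unfolding split t_def by (auto simp: e_def intro!: prod.cong)
      have eq: "xvar 1 ^ k * (const_poly c * (\<Prod>l=1..n. xvar l ^ i l)) =
          const_poly c * (\<Prod>l=1..n. xvar l ^ e l)"
        unfolding e split 0 t_def by (simp add: mult_ac)
      show ?thesis
      proof (cases "\<exists>l\<in>{1..h}. e l = 0")
        case True
        then obtain l where "l \<in> {1..h}" "e l = 0" by blast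
        then have "(\<Prod>l=1..n. xvar l ^ e l) \<in> S"
          using i k by (intro UnI1 x_elementsI) (auto simp: e_def)
        then show ?thesis unfolding eq by (rule T_S)
      next
        case False
        \<comment> \<open>For \<open>k = 0\<close> the entry \<open>e 1\<close> would be a zero,
          which is the previous case.\<close>
        then obtain k' where k': "k = Suc k'"
          using h1 by (cases k) (auto simp: e_def dest: bspec[of _ _ 1])
        have i_pos: "i l \<ge> 1" if "l \<in> {2..h}" for l
          using False that by (auto simp: e_def Suc_le_eq dest!: bspec[of _ _ l])
        have "\<exists>w\<in>generated (xvar ` {2..n}). t = (\<Prod>l=2..h. xvar l) * w"
          unfolding t_def using i_pos hn by (intro prod_power_factor) auto
        then obtain w where w: "w \<in> generated (xvar ` {2..n})" "t = (\<Prod>l=2..h. xvar l) * w" by blast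
        from w(1) have wX: "w \<in> X" by (rule generated_mono) auto
        have "\<exists>q\<in>X. (\<Prod>l=2..h. xvar 1 - xvar l) = (\<Prod>l=2..h. - xvar l) + xvar 1 * q"
          using hn by (intro prod_diff_split x1 x_in_X) auto
        then obtain q where q: "q \<in> X" "dfactor = (\<Prod>l=2..h. - xvar l) + xvar 1 * q"
          unfolding dfactor_def by blast
        define \<sigma> :: hpoly where "\<sigma> = (-1) ^ card {2..h}"
        have \<sigma>: "\<sigma> * \<sigma> = 1" "\<sigma> \<in> X"
          by (auto simp: \<sigma>_def power_mult_distrib[symmetric] intro!: generated_closed)
        have "(\<Prod>l=2..h. - xvar l) = \<sigma> * (\<Prod>l=2..h. xvar l)"
          unfolding \<sigma>_def by (rule prod_uminus)
        then have "\<sigma> * (dfactor - xvar 1 * q) = (\<sigma> * \<sigma>) * (\<Prod>l=2..h. xvar l)"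
          by (simp add: q(2) mult.assoc)
        then have px: "(\<Prod>l=2..h. xvar l) = \<sigma> * (dfactor - xvar 1 * q)" by (simp add: \<sigma>)
        \<comment> \<open>One factor of x_1^k completes D to x_1 D, which lies in \<open>I\<close>;
          what remains carries x_1^(k+1) and falls under the induction hypothesis.\<close>
        have "const_poly c * (\<Prod>l=1..n. xvar l ^ e l) =
            (xvar 1 * dfactor) * (const_poly c * xvar 1 ^ k' * \<sigma> * w) +
            xvar 1 ^ Suc k * (- (const_poly c * \<sigma> * q * w))"
          unfolding e w(2) px k' by (simp add: algebra_simps)
        also have "\<dots> \<in> T"
          by (intro T_add T_I I_mult x1_dfactor_in_I IH X_sub generated_times generated_uminus
              generated_power generated.const x1 \<sigma>(2) wX q(1))
        finally show ?thesis unfolding eq .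
      qed
    qed
    then show "const_poly c * (\<Prod>l=1..n. xvar l ^ i l) \<in> {p. xvar 1 ^ k * p \<in> T}" by simp
  qed (use Suc.prems in \<open>auto simp: distrib_left T_add\<close>)
  then show ?case by simp
qed

lemma X_in_T: "p \<in> X \<Longrightarrow> p \<in> T"
  using x1_power_mult_in_T[of p 0] by simp

lemma esym_xrev: "esym_fps xrev {1..n - 1} = esym_fps xvar {2..n}"
  unfolding esym_fps_def xrev_def
  by (rule prod.reindex_bij_witness[of _ "\<lambda>l. n + 1 - l" "\<lambda>j. n + 1 - j"]) auto

lemma image_xvar: "xvar ` {1..n} = insert (xvar 1) (xrev ` {1..n - 1})"
proof -
  have "xrev ` {1..n - 1} = xvar ` ((\<lambda>j. n + 1 - j) ` {1..n - 1})"
    by (simp add: image_image xrev_def)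
  also have "(\<lambda>j. n + 1 - j) ` {1..n - 1} = {2..n}"
    by (rule bij_betw_imp_surj_on[OF bij_betw_byWitness[where f' = "\<lambda>j. n + 1 - j"]]) auto
  finally have "xrev ` {1..n - 1} = xvar ` {2..n}" .
  moreover have "{1..n} = insert 1 {2..n}" using n2 by auto
  ultimately show ?thesis by simp
qed

text \<open>Both x_1 and x_(h+1) ... x_n annihilate z = y_(k+1) - y_1 modulo \<open>I\<close>. The
  first fact leaves the coinvariant relations in x_2, ..., x_n; the second removes the standard
  monomials divisible by that product.\<close>

lemma X_times_z_in_T:
  assumes k: "k \<in> {1..n - 1}" and p: "p \<in> X"
  shows "p * (yvar (k + 1) - yvar 1) \<in> T"
proof -
  define z where "z = yvar (k + 1) - yvar 1"
  have ks: "k + 1 \<in> {1..n}" "1 \<in> {1..n}" using k by auto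
  have zC: "z \<in> C" unfolding z_def using ks by (intro poly_ring_closed)
  have x1z: "xvar 1 * z \<in> I"
    unfolding z_def right_diff_distrib using ks by (intro I_diff x1y_in_I)
  have pz: "(\<Prod>l=1..n - h. xrev l) * z \<in> I"
  proof -
    \<comment> \<open>Subtracting the relations for the indices k + 1 and 1 cancels the product free
      of y.\<close>
    have "((\<Prod>l=h+1..n. - xvar l) * yvar (k + 1) - (\<Prod>l=2..n. - xvar l)) -
        ((\<Prod>l=h+1..n. - xvar l) * yvar 1 - (\<Prod>l=2..n. - xvar l)) \<in> I"
      using ks by (intro I_diff py_in_I)
    then have "(\<Prod>l=h+1..n. - xvar l) * z \<in> I" by (simp add: z_def right_diff_distrib)
    also have "(\<Prod>l=h+1..n. - xvar l) = (-1) ^ card {h+1..n} * (\<Prod>l=1..n - h. xrev l)"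
      using prod_xrev[of "\<lambda>x. x"] by (simp add: prod_uminus)
    finally have "(-1) ^ card {h+1..n} * ((-1) ^ card {h+1..n} * (\<Prod>l=1..n - h. xrev l) * z) \<in> I"
      by (rule I_mult_left) (intro poly_ring_power poly_ring_uminus poly_ring_one)
    moreover have "(-1) ^ card {h+1..n} * ((-1) ^ card {h+1..n} * (\<Prod>l=1..n - h. xrev l) * z) =
        ((-1) * (-1)) ^ card {h+1..n} * ((\<Prod>l=1..n - h. xrev l) * z)"
      by (simp only: power_mult_distrib mult_ac)
    ultimately show ?thesis by simp
  qed
  have sub: "q \<in> X" if "q \<in> generated (xrev ` {1..n - 1})" for q
    using that by (rule generated_mono) (unfold image_xvar, blast)
  interpret z: coinvariant xrev "n - 1" "{q \<in> C. q * z \<in> I}"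
  proof
    show "a * b \<in> {q \<in> C. q * z \<in> I}"
      if "a \<in> {q \<in> C. q * z \<in> I}" "b \<in> generated (xrev ` {1..n - 1})" for a b
    proof -
      from sub[OF that(2)] have "b \<in> C" by (rule X_sub)
      with that(1) I_mult[of "a * z" b] show ?thesis by (auto simp: mult_ac intro: poly_ring_closed)
    qed
    fix i :: nat assume i: "i \<ge> 1"
    then obtain i' where i': "i = Suc i'" by (cases i) auto
    have C': "fps_nth (esym_fps xvar {2..n}) j \<in> C" for j
      by (auto simp: esym_fps_nth intro!: poly_ring_closed)
    \<comment> \<open>Splitting off the factor of x_1 shows that the coefficients for x_2, ..., x_n
      and for x_1, ..., x_n differ by a multiple of x_1, which kills z.\<close>
    have "{1..n} = insert 1 {2..n}" using n2 by auto
    then have "esym_fps xvar {1..n} = (1 - fps_const (xvar 1) * fps_X) * esym_fps xvar {2..n}"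
      by (simp add: esym_fps_def)
    then have "fps_nth (esym_fps xvar {1..n}) i =
        fps_nth (esym_fps xvar {2..n}) i - xvar 1 * fps_nth (esym_fps xvar {2..n}) i'"
      by (simp add: i' left_diff_distrib mult.assoc)
    then have "fps_nth (esym_fps xvar {2..n}) i =
        fps_nth (esym_fps xvar {1..n}) i + xvar 1 * fps_nth (esym_fps xvar {2..n}) i'"
      by simp
    then have "fps_nth (esym_fps xvar {2..n}) i * z = fps_nth (esym_fps xvar {1..n}) i * z +
        (xvar 1 * z) * fps_nth (esym_fps xvar {2..n}) i'"
      by (simp only: distrib_right distrib_left mult_ac)
    also have "\<dots> \<in> I" by (intro I_add I_mult esym_in_I i zC x1z C')
    finally show "fps_nth (esym_fps xrev {1..n - 1}) i \<in> {q \<in> C. q * z \<in> I}"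
      unfolding esym_xrev using C' by simp
  qed (auto simp: distrib_right intro: I_0 I_add poly_ring_closed)
  have rev: "q \<in> {q. q * z \<in> T}" if q: "q \<in> generated (xrev ` {1..n - 1})" for q
  proof (rule z.standard_monomials_span)
    fix c and e :: "nat \<Rightarrow> nat" assume e: "\<And>l. l \<in> {1..n - 1} \<Longrightarrow> e l \<le> n - 1 - l"
    have "const_poly c * ((\<Prod>l=1..n - 1. xrev l ^ e l) * z) \<in> T"
    proof (cases "\<exists>l\<in>{1..n - h}. e l = 0")
      case True
      then obtain l where "l \<in> {1..n - h}" "e l = 0" by blast
      then show ?thesis unfolding z_def by (intro T_S UnI2 y_elementsI[of e l] e k)
    next
      case False
      then have "\<exists>w\<in>generated (xrev ` {1..n - 1}).
          (\<Prod>l=1..n - 1. xrev l ^ e l) = (\<Prod>l=1..n - h. xrev l) * w"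
        using h1 by (intro prod_power_factor) (auto simp: Suc_le_eq)
      then obtain w where w: "w \<in> X" "(\<Prod>l=1..n - 1. xrev l ^ e l) = (\<Prod>l=1..n - h. xrev l) * w"
        using sub by blast
      have "const_poly c * ((\<Prod>l=1..n - 1. xrev l ^ e l) * z) =
          ((\<Prod>l=1..n - h. xrev l) * z) * (const_poly c * w)"
        unfolding w(2) by (simp add: mult_ac)
      also have "\<dots> \<in> T" by (intro T_I I_mult pz poly_ring_mult poly_ring_const X_sub w(1))
      finally show ?thesis .
    qed
    then show "const_poly c * (\<Prod>l=1..n - 1. xrev l ^ e l) \<in> {q. q * z \<in> T}" by (simp add: mult_ac)
  qed (use q in \<open>auto simp: distrib_right T_add T_I\<close>)
  \<comment> \<open>Viewed as a polynomial in x_1 over the other variables, \<open>p\<close>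
    contributes only its terms free of x_1; the others lie in \<open>I\<close> after multiplication
    by z.\<close>
  have "p \<in> {q. q * z \<in> T}"
    using p unfolding image_xvar
  proof (rule generated_insert_induct)
    fix q r assume q: "q \<in> generated (xrev ` {1..n - 1})"
    show "q * xvar 1 ^ r \<in> {q. q * z \<in> T}"
    proof (cases r)
      case 0
      then show ?thesis using rev[OF q] by simp
    next
      case (Suc r')
      have "(xvar 1 * z) * (q * xvar 1 ^ r') \<in> T"
        using n2 by (intro T_I I_mult x1z poly_ring_closed X_sub sub q) auto
      then show ?thesis by (simp add: Suc mult_ac)
    qed
  qed (auto simp: distrib_right T_add)
  then show ?thesis by (simp add: z_def)
qed

text \<open>The sum relation gives n y_1 = D - sum of the y_(k+1) - y_1, and n is invertible in the
  complex numbers. The other y_k are y_1 plus a difference.\<close>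

lemma X_times_y_in_T:
  assumes k: "k \<in> {1..n}" and p: "p \<in> X"
  shows "p * yvar k \<in> T"
proof -
  have y1: "q * yvar 1 \<in> T" if q: "q \<in> X" for q
  proof -
    have "(\<Sum>k=1..n. yvar k) = yvar 1 + (\<Sum>k=Suc 1..n. yvar k)"
      using n2 by (intro sum.atLeast_Suc_atMost) auto
    also have "(\<Sum>k=Suc 1..n. yvar k) = (\<Sum>k=1..n - 1. yvar (Suc k))"
      by (rule sum.reindex_bij_witness[of _ Suc "\<lambda>k. k - 1"]) auto
    also have "yvar 1 + \<dots> = of_nat n * yvar 1 + (\<Sum>k=1..n - 1. yvar (k + 1) - yvar 1)"
      using n2 by (simp add: sum_subtractf algebra_simps of_nat_diff)
    finally have eq: "of_nat n * yvar 1 = ((\<Sum>k=1..n. yvar k) - dfactor) + dfactor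
        + (\<Sum>k=1..n - 1. - (yvar (k + 1) - yvar 1))"
      by (simp only: sum_negf) simp
    have expand: "r * (a + b + (\<Sum>k=1..n - 1. - z k)) = a * r + r * b + (\<Sum>k=1..n - 1. - r * z k)"
      for r a b :: hpoly and z
      by (simp add: algebra_simps sum_distrib_left sum_negf)
    define c where "c = const_poly (inverse (of_nat n))"
    have "const_poly (of_nat n) = of_nat n" by (simp add: const_poly_def)
    then have "c * of_nat n = 1"
      using n2 by (metis c_def const_poly_1 const_poly_mult left_inverse not_numeral_le_zero of_nat_eq_0_iff)
    then have "q * yvar 1 = (q * yvar 1) * (c * of_nat n)" by simp
    also have "\<dots> = (q * c) * (of_nat n * yvar 1)" by (simp only: mult_ac)
    also have "\<dots> = ((\<Sum>k=1..n. yvar k) - dfactor) * (q * c) + (q * c * dfactor)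
        + (\<Sum>k=1..n - 1. - (q * c) * (yvar (k + 1) - yvar 1))"
      unfolding eq by (rule expand)
    also have "\<dots> \<in> T"
    proof (intro T_add T_sum)
      have qc: "q * c \<in> X" unfolding c_def by (intro generated_times q generated.const)
      show "((\<Sum>k=1..n. yvar k) - dfactor) * (q * c) \<in> T"
        by (intro T_I I_mult sum_y_in_I X_sub qc)
      show "q * c * dfactor \<in> T" by (intro X_in_T generated_times[OF qc] dfactor_in_X)
      show "- (q * c) * (yvar (k + 1) - yvar 1) \<in> T" if "k \<in> {1..n - 1}" for k
        by (intro X_times_z_in_T that generated_uminus qc)
    qed
    finally show ?thesis .
  qed
  show ?thesis
  proof (cases "k = 1")
    case False
    then have "p * (yvar (k - 1 + 1) - yvar 1) \<in> T" using k p by (intro X_times_z_in_T) auto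
    then have "p * (yvar (k - 1 + 1) - yvar 1) + p * yvar 1 \<in> T" using y1[OF p] by (rule T_add)
    then show ?thesis using k False by (simp add: right_diff_distrib)
  qed (use y1 p in simp)
qed

text \<open>Modulo \<open>I\<close> every polynomial is linear in the y_k with coefficients in the
  x_l, because mixed products of the y_k vanish and squares reduce by
  \<open>y_squared_in_I\<close>.\<close>

theorem C_in_T: assumes "p \<in> C" shows "p \<in> T"
proof -
  have "\<exists>a b. a \<in> X \<and> (\<forall>k. b k \<in> X) \<and> p - (a + (\<Sum>k=1..n. b k * yvar k)) \<in> I"
    using assms unfolding carrier_poly_ring_eq_generated
  proof induction
    case (const c)
    show ?case
      by (rule exI[of _ "const_poly c"], rule exI[of _ "\<lambda>_. 0"]) (auto intro: generated_closed I_0)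
  next
    case (add p q)
    then obtain a b a' b' where ab: "a \<in> X" "\<forall>k. b k \<in> X" "p - (a + (\<Sum>k=1..n. b k * yvar k)) \<in> I"
      "a' \<in> X" "\<forall>k. b' k \<in> X" "q - (a' + (\<Sum>k=1..n. b' k * yvar k)) \<in> I" by blast
    have "p + q - (a + a' + (\<Sum>k=1..n. (b k + b' k) * yvar k)) =
      (p - (a + (\<Sum>k=1..n. b k * yvar k))) + (q - (a' + (\<Sum>k=1..n. b' k * yvar k)))"
      by (simp add: distrib_right sum.distrib)
    also have "\<dots> \<in> I" using ab by (intro I_add)
    finally show ?case
      using ab by (intro exI[of _ "a + a'"] exI[of _ "\<lambda>k. b k + b' k"]) (auto intro: generated.add)
  next
    case (mult p g)
    then obtain a b where ab: "a \<in> X" "\<And>k. b k \<in> X" "p - (a + (\<Sum>k=1..n. b k * yvar k)) \<in> I" by blast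
    let ?s = "\<Sum>k=1..n. b k * yvar k"
    consider l where "l \<in> {1..n}" "g = xvar l" | j where "j \<in> {1..n}" "g = yvar j"
      using mult(2) by (auto simp: hvars_def xvar_def yvar_def)
    then show ?case
    proof cases
      case (1 l)
      have "p * g - (a * xvar l + (\<Sum>k=1..n. b k * xvar l * yvar k)) = (p - (a + ?s)) * xvar l"
        by (simp add: 1 algebra_simps sum_distrib_left)
      also have "\<dots> \<in> I" using 1 by (intro I_mult ab poly_ring_x)
      finally show ?thesis using ab 1
        by (intro exI[of _ "a * xvar l"] exI[of _ "\<lambda>k. b k * xvar l"])
          (auto intro!: generated_times x_in_X simp del: One_nat_def)
    next
      case (2 j)
      \<comment> \<open>Multiplication by y_j kills the other y_k and turns b_j y_j^2 into b_j D
        y_j, so only the coefficient of y_j survives.\<close>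
      define b' where "b' = (\<lambda>k. if k = j then a + b j * dfactor else 0)"
      have "(\<Sum>k=1..n. b' k * yvar k) = (\<Sum>k=1..n. if k = j then (a + b j * dfactor) * yvar j else 0)"
        by (intro sum.cong) (auto simp: b'_def)
      then have b': "(\<Sum>k=1..n. b' k * yvar k) = (a + b j * dfactor) * yvar j" using 2 by simp
      have "?s = b j * yvar j + (\<Sum>k\<in>{1..n}-{j}. b k * yvar k)" using 2 by (simp add: sum.remove)
      then have "p * g - (0 + (\<Sum>k=1..n. b' k * yvar k)) =
          (p - (a + ?s)) * yvar j + ((yvar j * yvar j - dfactor * yvar j) * b j
          + (\<Sum>k\<in>{1..n}-{j}. (yvar k * yvar j) * b k))"
        unfolding b' by (simp add: 2 algebra_simps sum_distrib_left)
      also have "\<dots> \<in> I"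
        using 2 by (intro I_add I_sum I_mult ab poly_ring_y y_squared_in_I yy_in_I X_sub) auto
      finally show ?thesis using ab dfactor_in_X
        by (intro exI[of _ 0] exI[of _ b']) (auto simp: b'_def intro!: generated_closed)
    qed
  qed
  then obtain a b where ab: "a \<in> X" "\<And>k. b k \<in> X" "p - (a + (\<Sum>k=1..n. b k * yvar k)) \<in> I" by blast
  have "(p - (a + (\<Sum>k=1..n. b k * yvar k))) + (a + (\<Sum>k=1..n. b k * yvar k)) \<in> T"
    by (intro T_add T_sum X_times_y_in_T X_in_T T_I ab)
  then show ?thesis by simp
qed

end

section \<open>Evaluation at the permutation points\<close>

lemma sum_fun_apply: "sum f A w = (\<Sum>a\<in>A. f a w)"
  for f :: "'a \<Rightarrow> 'b \<Rightarrow> complex"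
  by (induction A rule: infinite_finite_induct) (auto simp: zero_fun_def)

text \<open>The space of complex functions in which the dimension count takes place.\<close>

interpretation fs: vector_space "\<lambda>(c :: complex) (f :: 'a \<Rightarrow> complex) w. c * f w"
  by unfold_locales (auto simp: fun_eq_iff algebra_simps)

lemma prod_monom:
  "(\<Prod>a\<in>A. Polynomial.monom (f a) (g a)) = Polynomial.monom (\<Prod>a\<in>A. f a) (\<Sum>a\<in>A. g a)"
  by (induction A rule: infinite_finite_induct) (auto simp: mult_monom)

context hessenberg
begin

text \<open>The point of the deformed variety attached to a permutation \<open>w\<close>: the torus fixed points of the
  Hessenberg variety, with equivariant parameters $t_i = i$.\<close>

definition pt :: "(nat \<Rightarrow> nat) \<Rightarrow> hvar \<Rightarrow> complex" where
  "pt w v = (case v of XVar i \<Rightarrow> of_nat (w i)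
     | YVar k \<Rightarrow> if w 1 = k then \<Prod>l=2..h. of_nat k - of_nat (w l) else 0)"

text \<open>Half the cohomological degree; for h = 1 the y_k have weight 0.\<close>

definition weight :: "hvar \<Rightarrow> nat" where
  "weight v = (case v of XVar i \<Rightarrow> 1 | YVar k \<Rightarrow> h - 1)"

text \<open>The exponent of the polynomial variable records the weight, so the coefficient of degree \<open>d\<close> is
  the value at \<open>w\<close> of the weight-\<open>d\<close> component of the argument.\<close>

definition graded_eval :: "(nat \<Rightarrow> nat) \<Rightarrow> hpoly \<Rightarrow> complex poly" where
  "graded_eval w = eval_hpoly (\<lambda>v. Polynomial.monom (pt w v) (weight v))"

abbreviation "W \<equiv> {w. w permutes {1..n}}"

section \<open>Weight components and their filtration\<close>

definition component :: "nat \<Rightarrow> hpoly \<Rightarrow> (nat \<Rightarrow> nat) \<Rightarrow> complex" where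
  "component d p = (\<lambda>w. if w \<in> W then Polynomial.coeff (graded_eval w p) d else 0)"

text \<open>The functions coming from weights strictly below \<open>d\<close>. A homogeneous
  polynomial of weight \<open>d\<close> with values in \<open>F d\<close> agrees on the points with
  terms of lower weight.\<close>

definition F :: "nat \<Rightarrow> ((nat \<Rightarrow> nat) \<Rightarrow> complex) set" where
  "F d = fs.span {component e p | e p. e < d \<and> p \<in> C}"

lemma component_add: "component d (p + q) = component d p + component d q"
  by (auto simp: component_def graded_eval_def eval_hpoly_add)

lemma component_const_mult: "component d (const_poly c * p) = (\<lambda>w. c * component d p w)"
  by (auto simp: component_def graded_eval_def eval_hpoly_simps)

lemma component_0: "component d 0 = 0"
  by (auto simp: component_def graded_eval_def)

lemma component_sum: "component d (sum f A) = (\<Sum>a\<in>A. component d (f a))"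
  by (induction A rule: infinite_finite_induct) (auto simp: component_0 component_add)

lemma component_mult_var: "component d (p * var_poly v) =
    (if weight v \<le> d then (\<lambda>w. pt w v * component (d - weight v) p w) else 0)"
  by (auto simp: component_def graded_eval_def eval_hpoly_simps coeff_monom_mult mult.commute[of "eval_hpoly _ _"])

lemma component_homogeneous:
  assumes "\<And>w. w \<in> W \<Longrightarrow> graded_eval w p = Polynomial.monom (\<rho> w) D"
  shows "component d p = (if d = D then (\<lambda>w. if w \<in> W then \<rho> w else 0) else 0)"
  using assms by (auto simp: component_def)

lemma F_0: "0 \<in> F d" unfolding F_def by (rule fs.span_zero)
lemma F_add: "f \<in> F d \<Longrightarrow> g \<in> F d \<Longrightarrow> f + g \<in> F d" unfolding F_def by (rule fs.span_add)
lemma F_diff: "f \<in> F d \<Longrightarrow> g \<in> F d \<Longrightarrow> f - g \<in> F d" unfolding F_def by (rule fs.span_diff)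
lemma F_scale: "f \<in> F d \<Longrightarrow> (\<lambda>w. c * f w) \<in> F d" unfolding F_def by (rule fs.span_scale)

lemma F_base: "e < d \<Longrightarrow> p \<in> C \<Longrightarrow> component e p \<in> F d"
  unfolding F_def by (rule fs.span_base) blast

text \<open>A spanning component of \<open>p\<close> becomes the component of
  \<open>p * var_poly v\<close> whose index is larger by \<open>weight v\<close>.\<close>

lemma F_mult_var:
  assumes "v \<in> hvars n" "f \<in> F d"
  shows "(\<lambda>w. pt w v * f w) \<in> F (d + weight v)"
  using assms(2) unfolding F_def[of d]
proof (induction rule: fs.span_induct_alt)
  case base
  show ?case using F_0 by (simp add: zero_fun_def)
next
  case (step c g y)
  then obtain e p where ep: "g = component e p" "e < d" "p \<in> C" by blast
  have "p * var_poly v \<in> C"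
    using ep(3) assms(1) unfolding carrier_poly_ring_eq_generated by (blast intro: generated.mult)
  then have "component (e + weight v) (p * var_poly v) \<in> F (d + weight v)"
    using ep(2) by (intro F_base) auto
  then have "(\<lambda>w. pt w v * g w) \<in> F (d + weight v)"
    by (simp add: component_mult_var ep(1))
  from F_add[OF F_scale[OF this, of c] step.IH]
  show ?case by (simp add: plus_fun_def algebra_simps)
qed

lemma F_mult_x:
  assumes "l \<in> {1..n}" "f \<in> F d"
  shows "(\<lambda>w. of_nat (w l) * f w) \<in> F (Suc d)"
  using F_mult_var[of "XVar l" f d] assms by (auto simp: hvars_def pt_def weight_def)

lemma F_prod_shift:
  assumes "finite L" "L \<subseteq> {1..n}" "g \<in> F d"
  shows "(\<lambda>w. (\<Prod>l\<in>L. t - of_nat (w l)) * g w) \<in> F (d + card L)"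
  using assms
proof (induction L rule: finite_induct)
  case (insert l L)
  let ?g = "\<lambda>w. (\<Prod>l\<in>L. t - of_nat (w l)) * g w"
  have "?g \<in> F (d + card L)" using insert by auto
  moreover have "F (d + card L) \<subseteq> F (Suc (d + card L))"
    unfolding F_def by (rule fs.span_mono) (blast intro: less_SucI)
  ultimately have "(\<lambda>w. t * ?g w) - (\<lambda>w. of_nat (w l) * ?g w) \<in> F (Suc (d + card L))"
    using insert.prems by (intro F_diff F_scale F_mult_x) auto
  then show ?case using insert.hyps by (simp add: fun_diff_def algebra_simps)
qed simp

text \<open>The leading terms of the two products agree, which gains one degree over
  \<open>F_prod_shift\<close>. With P and Q for the products, the induction uses (t - a) P + a Q = t
  P - a (P - Q).\<close>

lemma F_prod_shift_diff:
  assumes "finite L" "L \<subseteq> {1..n}" "g \<in> F (Suc d)"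
  shows "(\<lambda>w. ((\<Prod>l\<in>L. t - of_nat (w l)) - (\<Prod>l\<in>L. - of_nat (w l))) * g w) \<in> F (d + card L)"
  using assms
proof (induction L rule: finite_induct)
  case empty
  then show ?case using F_0 by (simp add: zero_fun_def)
next
  case (insert l L)
  let ?f = "\<lambda>w. ((\<Prod>l\<in>L. t - of_nat (w l)) - (\<Prod>l\<in>L. - of_nat (w l))) * g w"
  let ?g = "\<lambda>w. (\<Prod>l\<in>L. t - of_nat (w l)) * g w"
  have "?f \<in> F (d + card L)" using insert by auto
  moreover have "?g \<in> F (Suc d + card L)" using insert by (intro F_prod_shift) auto
  ultimately have "(\<lambda>w. t * ?g w) - (\<lambda>w. of_nat (w l) * ?f w) \<in> F (Suc (d + card L))"
    using insert.prems by (intro F_diff F_scale F_mult_x) auto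
  then show ?case using insert.hyps by (simp add: fun_diff_def algebra_simps)
qed

lemma graded_eval_x: "graded_eval w (xvar i) = Polynomial.monom (of_nat (w i)) 1"
  by (simp add: graded_eval_def xvar_def pt_def weight_def)

lemma graded_eval_y: "graded_eval w (yvar k) = Polynomial.monom (pt w (YVar k)) (h - 1)"
  by (simp add: graded_eval_def yvar_def weight_def)

lemmas graded_eval_simps = eval_hpoly_simps[where f = "\<lambda>v. Polynomial.monom (pt w v) (weight v)" for w,
    folded graded_eval_def] graded_eval_x graded_eval_y

section \<open>The relations at the permutation points\<close>

lemma pt_y_mult: "of_nat (w 1) * pt w (YVar k) = of_nat k * pt w (YVar k)"
  by (simp add: pt_def)

lemma W_mem: "w \<in> W \<Longrightarrow> l \<in> {1..n} \<Longrightarrow> w l \<in> {1..n}"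
  using permutes_in_image[of w "{1..n}" l] by simp

text \<open>Polynomials each of whose weight components agrees on the points with a combination of
  components of lower weight. This is an ideal containing the relations, hence it contains
  \<open>I\<close>.\<close>

definition K :: "hpoly set" where
  "K = {p \<in> C. \<forall>d. component d p \<in> F d}"

lemma homogeneous_in_K:
  assumes "p \<in> C" "\<And>w. w \<in> W \<Longrightarrow> graded_eval w p = Polynomial.monom (\<rho> w) D"
    and "(\<lambda>w. if w \<in> W then \<rho> w else 0) \<in> F D"
  shows "p \<in> K"
  using assms component_homogeneous[OF assms(2)] F_0 by (auto simp: K_def)

lemma yy_in_K:
  assumes "k \<in> {1..n}" "k' \<in> {1..n}" "k \<noteq> k'"
  shows "yvar k * yvar k' \<in> K"
proof (rule homogeneous_in_K)
  show "graded_eval w (yvar k * yvar k') = Polynomial.monom 0 0" for w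
    using assms by (auto simp: graded_eval_simps mult_monom pt_def)
  show "(\<lambda>w. if w \<in> W then 0 else 0) \<in> F 0" using F_0 by (simp add: zero_fun_def)
qed (use assms in \<open>auto intro!: poly_ring_closed\<close>)

text \<open>At the points x_1 y_k = k y_k, and the right side has weight h - 1 instead of h.\<close>

lemma x1y_in_K:
  assumes "k \<in> {1..n}" shows "xvar 1 * yvar k \<in> K"
proof (rule homogeneous_in_K)
  show "graded_eval w (xvar 1 * yvar k) = Polynomial.monom (of_nat k * pt w (YVar k)) h" for w
    using h1 by (simp add: graded_eval_simps mult_monom pt_y_mult[simplified])
  have "(\<lambda>w. of_nat k * component (h - 1) (yvar k) w) \<in> F h"
    using h1 assms by (intro F_scale F_base poly_ring_y) auto
  also have "(\<lambda>w. of_nat k * component (h - 1) (yvar k) w) =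
      (\<lambda>w. if w \<in> W then of_nat k * pt w (YVar k) else 0)"
    by (auto simp: component_def graded_eval_y)
  finally show "(\<lambda>w. if w \<in> W then of_nat k * pt w (YVar k) else 0) \<in> F h" .
qed (use assms in \<open>auto intro!: poly_ring_closed\<close>)

text \<open>At the points the product of the k - x_l over l > h, times y_k, equals the product of
  the k - x_l over l \<ge> 2. Discarding the shift by k costs only lower weight, by
  \<open>F_prod_shift_diff\<close>.\<close>

lemma py_in_K:
  assumes k: "k \<in> {1..n}"
  shows "(\<Prod>l=h+1..n. - xvar l) * yvar k - (\<Prod>l=2..n. - xvar l) \<in> K"
proof (rule homogeneous_in_K)
  let ?\<rho> = "\<lambda>w. (\<Prod>l=h+1..n. - of_nat (w l)) * pt w (YVar k) - (\<Prod>l=2..n. - of_nat (w l))"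
  have 1: "n - h + (h - 1) = n - 1" using h1 hn by simp
  have "graded_eval w ((\<Prod>l=h+1..n. - xvar l) * yvar k - (\<Prod>l=2..n. - xvar l)) =
      Polynomial.monom ((\<Prod>l=h+1..n. - of_nat (w l)) * pt w (YVar k)) (n - h + (h - 1))
      - Polynomial.monom (\<Prod>l=2..n. - of_nat (w l)) (n - 1)" for w
    by (simp add: graded_eval_simps minus_monom prod_monom mult_monom)
  then show "graded_eval w ((\<Prod>l=h+1..n. - xvar l) * yvar k - (\<Prod>l=2..n. - xvar l)) =
      Polynomial.monom (?\<rho> w) (n - 1)" for w
    by (simp only: 1 diff_monom)
  let ?f = "\<lambda>L w. (\<Prod>l\<in>L. of_nat k - of_nat (w l)) - (\<Prod>l\<in>L. - of_nat (w l)) :: complex"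
  have "component (h - 1) (yvar k) \<in> F (Suc (h - 1))" "component 0 1 \<in> F (Suc 0)"
    using k by (auto intro!: F_base poly_ring_closed)
  then have "(\<lambda>w. ?f {2..n} w * component 0 1 w) \<in> F (0 + card {2..n})"
    and "(\<lambda>w. ?f {h+1..n} w * component (h - 1) (yvar k) w) \<in> F (h - 1 + card {h+1..n})"
    by (intro F_prod_shift_diff; auto)+
  moreover have "0 + card {2..n} = n - 1" "h - 1 + card {h+1..n} = n - 1" using h1 hn by auto
  ultimately have "(\<lambda>w. ?f {2..n} w * component 0 1 w)
      - (\<lambda>w. ?f {h+1..n} w * component (h - 1) (yvar k) w) \<in> F (n - 1)"
    by (intro F_diff) (simp_all only:)
  also have "(\<lambda>w. ?f {2..n} w * component 0 1 w) - (\<lambda>w. ?f {h+1..n} w * component (h - 1) (yvar k) w) =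
      (\<lambda>w. if w \<in> W then ?\<rho> w else 0)"
  proof
    fix w
    show "((\<lambda>w. ?f {2..n} w * component 0 1 w) - (\<lambda>w. ?f {h+1..n} w * component (h - 1) (yvar k) w)) w =
      (if w \<in> W then ?\<rho> w else 0)"
    proof (cases "w \<in> W")
      case False
      then show ?thesis by (simp add: component_def)
    next
      case True
      have c: "component (h - 1) (yvar k) w = pt w (YVar k)" "component 0 1 w = 1"
        using True by (simp_all add: component_def graded_eval_y) (simp add: graded_eval_def)
      have "(\<Prod>l=2..n. of_nat k - of_nat (w l)) =
          (\<Prod>l=h+1..n. of_nat k - of_nat (w l)) * pt w (YVar k)"
      proof (cases "w 1 = k")
        case True
        have "{2..n} = {2..h} \<union> {h+1..n}" using h1 hn by auto
        moreover have "(\<Prod>l\<in>{2..h} \<union> {h+1..n}. of_nat k - of_nat (w l) :: complex) =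
            (\<Prod>l=2..h. of_nat k - of_nat (w l)) * (\<Prod>l=h+1..n. of_nat k - of_nat (w l))"
          by (rule prod.union_disjoint) auto
        ultimately show ?thesis using True by (simp add: pt_def)
      next
        case False
        \<comment> \<open>The permutation takes the value k at some l \<ge> 2, so both sides are
          0.\<close>
        obtain l where l: "l \<in> {1..n}" "w l = k"
          using True k permutes_image[of w "{1..n}"] by (metis (mono_tags) imageE mem_Collect_eq)
        with False have "l \<noteq> 1" by auto
        with l have "l \<in> {2..n}" "of_nat k - of_nat (w l) = (0 :: complex)" by auto
        then have "(\<Prod>l=2..n. of_nat k - of_nat (w l)) = (0 :: complex)"
          by (intro prod_zero) auto
        then show ?thesis using False by (simp add: pt_def)
      qed
      then show ?thesis using True unfolding fun_diff_def c by (simp add: algebra_simps)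
    qed
  qed
  finally show "(\<lambda>w. if w \<in> W then ?\<rho> w else 0) \<in> F (n - 1)" .
qed (use k in \<open>auto intro!: poly_ring_closed\<close>)

text \<open>At a point only y_k with k = w(1) can be nonzero, and there it has the value of D; this
  relation holds without lower terms.\<close>

lemma sum_y_in_K: "(\<Sum>k=1..n. yvar k) - (\<Prod>l=2..h. xvar 1 - xvar l) \<in> K"
proof (rule homogeneous_in_K)
  fix w assume w: "w \<in> W"
  have "graded_eval w ((\<Sum>k=1..n. yvar k) - (\<Prod>l=2..h. xvar 1 - xvar l)) =
      Polynomial.monom (\<Sum>k=1..n. pt w (YVar k)) (h - 1) -
      Polynomial.monom (\<Prod>l=2..h. of_nat (w 1) - of_nat (w l)) (h - 1)"
    by (simp add: graded_eval_simps diff_monom prod_monom monom_sum)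
  moreover have "(\<Sum>k=1..n. pt w (YVar k)) = (\<Prod>l=2..h. of_nat (w 1) - of_nat (w l))"
    using W_mem[OF w, of 1] n2 by (simp add: pt_def)
  ultimately show "graded_eval w ((\<Sum>k=1..n. yvar k) - (\<Prod>l=2..h. xvar 1 - xvar l)) =
      Polynomial.monom 0 0" by simp
next
  show "(\<lambda>w. if w \<in> W then 0 else 0) \<in> F 0" using F_0 by (simp add: zero_fun_def)
qed (use h1 hn in \<open>auto intro!: poly_ring_closed\<close>)

text \<open>At every point the value is the constant e_i(1, ..., n), which has weight 0 < i.\<close>

lemma elem_sym_in_K:
  assumes i: "i \<in> {1..n}" shows "elem_sym n i \<in> K"
proof (rule homogeneous_in_K)
  define c :: complex where "c = (\<Sum>A | A \<subseteq> {1..n} \<and> card A = i. \<Prod>j\<in>A. of_nat j)"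
  fix w assume w: "w \<in> W"
  have "graded_eval w (elem_sym n i) =
      (\<Sum>A | A \<subseteq> {1..n} \<and> card A = i. Polynomial.monom (\<Prod>j\<in>A. of_nat (w j)) i)"
    unfolding elem_sym_def graded_eval_simps by (intro sum.cong) (auto simp: prod_monom)
  also have "\<dots> = Polynomial.monom (\<Sum>A | A \<subseteq> {1..n} \<and> card A = i. \<Prod>j\<in>A. of_nat (w j)) i"
    by (simp add: monom_sum)
  also have "(\<Sum>A | A \<subseteq> {1..n} \<and> card A = i. \<Prod>j\<in>A. of_nat (w j)) = c"
  proof -
    \<comment> \<open>Invariance is read off from the generating function, a product whose factors
      \<open>w\<close> permutes.\<close>
    have "esym_fps (\<lambda>j. of_nat (w j)) {1..n} = (esym_fps of_nat {1..n} :: complex fps)"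
      unfolding esym_fps_def
      using prod.permute[of w "{1..n}" "\<lambda>j. 1 - fps_const (of_nat j :: complex) * fps_X"] w
      by (simp add: o_def)
    from arg_cong[OF this, of "\<lambda>f. fps_nth f i"] show ?thesis
      by (simp add: esym_fps_nth c_def)
  qed
  finally show "graded_eval w (elem_sym n i) = Polynomial.monom c i" .
next
  define c :: complex where "c = (\<Sum>A | A \<subseteq> {1..n} \<and> card A = i. \<Prod>j\<in>A. of_nat j)"
  have "component 0 (const_poly c) \<in> F i" using i by (intro F_base poly_ring_closed) auto
  also have "component 0 (const_poly c) = (\<lambda>w. if w \<in> W then c else 0)"
    by (auto simp: component_def graded_eval_simps)
  finally show "(\<lambda>w. if w \<in> W then (\<Sum>A | A \<subseteq> {1..n} \<and> card A = i. \<Prod>j\<in>A. of_nat j) else 0) \<in> F i"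
    by (simp only: c_def)
qed (auto simp: elem_sym_def intro!: poly_ring_closed)

text \<open>One generator at a time: a variable shifts the index of a component and the filtration
  by the same weight, and components of smaller index vanish.\<close>

lemma K_mult: assumes "a \<in> K" "b \<in> C" shows "a * b \<in> K"
  using assms(2) unfolding carrier_poly_ring_eq_generated
proof induction
  case (const c)
  have "component d (const_poly c * a) \<in> F d" for d
    unfolding component_const_mult using assms(1) by (intro F_scale) (auto simp: K_def)
  then show ?case using assms(1) by (auto simp: K_def mult.commute intro: poly_ring_closed)
next
  case (add p q)
  then show ?case by (auto simp: K_def distrib_left component_add intro: F_add poly_ring_closed)
next
  case (mult p g)
  then obtain v where v: "v \<in> hvars n" "g = var_poly v" by blast
  have "component d ((a * p) * var_poly v) \<in> F d" for d
  proof (cases "weight v \<le> d")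
    case True
    have "component (d - weight v) (a * p) \<in> F (d - weight v)" using mult.IH by (simp add: K_def)
    from F_mult_var[OF v(1) this] True show ?thesis by (simp add: component_mult_var)
  qed (simp add: component_mult_var F_0)
  moreover have "g \<in> C"
    unfolding carrier_poly_ring_eq_generated using mult(2) by (rule generated_base)
  moreover have "a * p \<in> C" using mult.IH by (simp add: K_def)
  ultimately have "a * p * g \<in> K" using v by (auto simp: K_def intro: poly_ring_closed)
  then show ?case by (simp add: mult.assoc)
qed

lemma a_inv_poly_ring: "p \<in> C \<Longrightarrow> \<ominus>\<^bsub>poly_ring n\<^esub> p = - p"
  using abelian_group.minus_equality[OF ring.is_abelian_group[OF cring.axioms(1)[OF cring_poly_ring]],
      of _ "- p" p] by (simp add: poly_ring_uminus)

lemma I_subset_K: "I \<subseteq> K"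
proof -
  interpret R: cring "poly_ring n" by (rule cring_poly_ring)
  have neg: "- a \<in> K" if "a \<in> K" for a
    using K_mult[OF that poly_ring_const[of "-1"]] by (simp add: const_poly_uminus_1)
  have "ideal K (poly_ring n)"
  proof (rule idealI)
    show "subgroup K (add_monoid (poly_ring n))"
    proof (rule R.add.subgroupI)
      show "K \<noteq> {}" using component_0 F_0 poly_ring_zero by (auto simp: K_def)
    next
      fix a assume a: "a \<in> K"
      then have "a \<in> C" by (simp add: K_def)
      then show "\<ominus>\<^bsub>poly_ring n\<^esub> a \<in> K" using neg[OF a] by (simp add: a_inv_poly_ring)
    qed (auto simp: K_def component_add intro: F_add poly_ring_closed)
  qed (use K_mult in \<open>auto simp: mult.commute R.ring_axioms\<close>)
  moreover have "hess_relations n h \<subseteq> K"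
    unfolding hess_relations_def
    using yy_in_K x1y_in_K py_in_K sum_y_in_K elem_sym_in_K by blast
  ultimately show ?thesis unfolding hess_ideal_def by (rule R.genideal_minimal)
qed

section \<open>Linear independence on the points\<close>

lemma S_homogeneous: assumes "s \<in> S" shows "\<exists>D. \<forall>d. d \<noteq> D \<longrightarrow> component d s = 0"
proof -
  have "\<exists>D \<rho>. \<forall>w. graded_eval w s = Polynomial.monom (\<rho> w) D"
    using assms
  proof
    assume "s \<in> x_elements n h"
    then obtain i where "s = (\<Prod>l=1..n. xvar l ^ i l)" by (auto simp: x_elements_def)
    then have "graded_eval w s = Polynomial.monom (\<Prod>l=1..n. of_nat (w l) ^ i l) (\<Sum>l=1..n. i l)" for w
      by (simp add: graded_eval_simps monom_power prod_monom)
    then show ?thesis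
      by (intro exI[of _ "\<Sum>l=1..n. i l"] exI[of _ "\<lambda>w. \<Prod>l=1..n. of_nat (w l) ^ i l"]) blast
  next
    assume "s \<in> y_elements n h"
    then obtain e k where "s = (\<Prod>j=1..n-1. xvar (n + 1 - j) ^ e j) * (yvar (k + 1) - yvar 1)"
      unfolding y_elements_def by blast
    then have "graded_eval w s = Polynomial.monom ((\<Prod>j=1..n-1. of_nat (w (n + 1 - j)) ^ e j) *
        (pt w (YVar (k + 1)) - pt w (YVar 1))) ((\<Sum>j=1..n-1. e j) + (h - 1))" for w
      by (simp add: graded_eval_simps monom_power prod_monom diff_monom mult_monom)
    then show ?thesis
      by (intro exI[of _ "(\<Sum>j=1..n-1. e j) + (h - 1)"] exI[of _ "\<lambda>w.
          (\<Prod>j=1..n-1. of_nat (w (n + 1 - j)) ^ e j) * (pt w (YVar (k + 1)) - pt w (YVar 1))"]) blast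
  qed
  then obtain D \<rho> where "\<And>w. graded_eval w s = Polynomial.monom (\<rho> w) D" by blast
  from component_homogeneous[OF this] show ?thesis by auto
qed

text \<open>The weight is pinned down only by the vanishing of the other components, which treats
  both families alike.\<close>

definition dg :: "hpoly \<Rightarrow> nat" where
  "dg s = (SOME D. \<forall>d. d \<noteq> D \<longrightarrow> component d s = 0)"

definition ev :: "hpoly \<Rightarrow> (nat \<Rightarrow> nat) \<Rightarrow> complex" where
  "ev s = component (dg s) s"

lemma component_S: "s \<in> S \<Longrightarrow> component d s = (if d = dg s then ev s else 0)"
  using someI_ex[OF S_homogeneous[of s]] by (auto simp: ev_def dg_def)

text \<open>Strong induction on \<open>d\<close>. By \<open>C_in_T\<close>, \<open>p\<close> differs
  from a combination of \<open>S\<close> by an element of \<open>I\<close>, whose component comes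
  from lower weights and is covered by the induction hypothesis.\<close>

lemma component_in_span:
  "p \<in> C \<Longrightarrow> component d p \<in> fs.span (ev ` {s \<in> S. dg s \<le> d})"
proof (induction d arbitrary: p rule: less_induct)
  case (less d)
  from C_in_T[OF less.prems] obtain c where c: "p - (\<Sum>s\<in>S. const_poly (c s) * s) \<in> I"
    by (auto simp: T_def)
  define q where "q = p - (\<Sum>s\<in>S. const_poly (c s) * s)"
  have "F d \<subseteq> fs.span (ev ` {s \<in> S. dg s \<le> d})"
    unfolding F_def
  proof (rule fs.span_minimal)
    show "{component e p |e p. e < d \<and> p \<in> C} \<subseteq> fs.span (ev ` {s \<in> S. dg s \<le> d})"
    proof safe
      fix e p assume "e < d" "p \<in> C"
      then have "component e p \<in> fs.span (ev ` {s \<in> S. dg s \<le> e})" by (rule less.IH)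
      also have "\<dots> \<subseteq> fs.span (ev ` {s \<in> S. dg s \<le> d})"
        using \<open>e < d\<close> by (intro fs.span_mono) auto
      finally show "component e p \<in> fs.span (ev ` {s \<in> S. dg s \<le> d})" .
    qed
  qed (rule fs.subspace_span)
  moreover have "component d q \<in> F d" using c I_subset_K by (auto simp: K_def q_def)
  moreover have "component d (\<Sum>s\<in>S. const_poly (c s) * s) \<in> fs.span (ev ` {s \<in> S. dg s \<le> d})"
    unfolding component_sum component_const_mult
  proof (intro fs.span_sum fs.span_scale)
    fix s assume "s \<in> S"
    then show "component d s \<in> fs.span (ev ` {s \<in> S. dg s \<le> d})"
      unfolding component_S[OF \<open>s \<in> S\<close>] by (auto intro: fs.span_base fs.span_zero)
  qed
  ultimately have "component d q + component d (\<Sum>s\<in>S. const_poly (c s) * s)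
      \<in> fs.span (ev ` {s \<in> S. dg s \<le> d})"
    by (intro fs.span_add) auto
  then show ?case by (simp add: component_add[symmetric] q_def)
qed

lemma F_subset_span: "F d \<subseteq> fs.span (ev ` {s \<in> S. dg s < d})"
  unfolding F_def
proof (rule fs.span_minimal)
  show "{component e p |e p. e < d \<and> p \<in> C} \<subseteq> fs.span (ev ` {s \<in> S. dg s < d})"
  proof safe
    fix e p assume "e < d" "p \<in> C"
    then have "component e p \<in> fs.span (ev ` {s \<in> S. dg s \<le> e})" by (intro component_in_span)
    also have "\<dots> \<subseteq> fs.span (ev ` {s \<in> S. dg s < d})"
      using \<open>e < d\<close> by (intro fs.span_mono) auto
    finally show "component e p \<in> fs.span (ev ` {s \<in> S. dg s < d})" .
  qed
qed (rule fs.subspace_span)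

definition delta :: "(nat \<Rightarrow> nat) \<Rightarrow> (nat \<Rightarrow> nat) \<Rightarrow> complex" where
  "delta v = (\<lambda>w. if w = v then 1 else 0)"

lemma finite_W: "finite W"
  by (simp add: finite_permutations)

text \<open>A Lagrange interpolation polynomial for the point \<open>v\<close> is split into its
  weight components.\<close>

lemma delta_in_span:
  assumes v: "v \<in> W" shows "delta v \<in> fs.span (ev ` S)"
proof -
  define p where "p = (\<Prod>i=1..n. \<Prod>j\<in>{1..n}-{v i}.
    (xvar i - const_poly (of_nat j)) * const_poly (inverse (of_nat (v i) - of_nat j)))"
  have pC: "p \<in> C" unfolding p_def by (intro poly_ring_closed) auto
  \<comment> \<open>Evaluation at 1 adds up all weight components and gives the ordinary value at
    the point.\<close>
  have val: "poly (graded_eval w p) 1 = delta v w" if w: "w \<in> W" for w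
  proof -
    have "poly (graded_eval w p) 1 = (\<Prod>i=1..n. \<Prod>j\<in>{1..n}-{v i}.
        (of_nat (w i) - of_nat j) * inverse (of_nat (v i) - of_nat j))"
      by (simp add: p_def graded_eval_simps poly_prod poly_monom)
    also have "\<dots> = delta v w"
    proof (cases "w = v")
      case True
      have "(of_nat (v i) - of_nat j) * inverse (of_nat (v i) - of_nat j) = (1 :: complex)"
        if "j \<in> {1..n} - {v i}" for i j using that by (intro right_inverse) auto
      then show ?thesis using True by (simp add: delta_def)
    next
      case False
      then obtain i where i: "w i \<noteq> v i" by blast
      have iN: "i \<in> {1..n}"
        using i v w permutes_not_in[of v "{1..n}" i] permutes_not_in[of w "{1..n}" i] by force
      have "(\<Prod>j\<in>{1..n}-{v i}. (of_nat (w i) - of_nat j) * inverse (of_nat (v i) - of_nat j)) = (0 :: complex)"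
        using i W_mem[OF w iN] by (intro prod_zero) (auto intro!: bexI[of _ "w i"])
      then have "(\<Prod>i=1..n. \<Prod>j\<in>{1..n}-{v i}.
          (of_nat (w i) - of_nat j) * inverse (of_nat (v i) - of_nat j)) = (0 :: complex)"
        using iN by (intro prod_zero) auto
      then show ?thesis using False by (simp add: delta_def)
    qed
    finally show ?thesis .
  qed
  \<comment> \<open>A common degree bound, so that one finite sum of components serves all
    points.\<close>
  define N where "N = (\<Sum>w\<in>W. Polynomial.degree (graded_eval w p))"
  have "delta v = (\<Sum>d\<le>N. component d p)"
  proof
    fix w
    show "delta v w = (\<Sum>d\<le>N. component d p) w"
    proof (cases "w \<in> W")
      case True
      have "Polynomial.degree (graded_eval w p) \<le> N"
        unfolding N_def by (rule member_le_sum) (use True finite_W in auto)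
      then have "(\<Sum>d\<le>Polynomial.degree (graded_eval w p). Polynomial.coeff (graded_eval w p) d) =
          (\<Sum>d\<le>N. Polynomial.coeff (graded_eval w p) d)"
        by (intro sum.mono_neutral_left) (auto simp: coeff_eq_0)
      then show ?thesis
        using val[OF True] True by (simp add: poly_altdef sum_fun_apply component_def)
    next
      case False
      then show ?thesis using v by (auto simp: sum_fun_apply component_def delta_def)
    qed
  qed
  also have "\<dots> \<in> fs.span (ev ` S)"
  proof (rule fs.span_sum)
    fix d
    show "component d p \<in> fs.span (ev ` S)"
      using component_in_span[OF pC, of d] fs.span_mono[of "ev ` {s \<in> S. dg s \<le> d}" "ev ` S"] by blast
  qed
  finally show ?thesis .
qed

lemma inj_on_delta: "inj_on delta W"
  by (auto simp: inj_on_def delta_def fun_eq_iff split: if_splits)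

lemma independent_delta: "fs.independent (delta ` W)"
proof (rule fs.independent_if_scalars_zero)
  fix f x assume sum: "(\<Sum>x\<in>delta ` W. (\<lambda>w. f x * x w)) = 0" and "x \<in> delta ` W"
  then obtain v where v: "v \<in> W" "x = delta v" by blast
  have "0 = (\<Sum>x\<in>delta ` W. (\<lambda>w. f x * x w)) v" by (simp only: sum zero_fun_def)
  also have "\<dots> = (\<Sum>u\<in>W. f (delta u) * delta u v)"
    unfolding sum_fun_apply by (subst sum.reindex[OF inj_on_delta]) simp
  also have "\<dots> = (\<Sum>u\<in>W. if u = v then f (delta v) else 0)"
    by (intro sum.cong) (auto simp: delta_def)
  also have "\<dots> = f x" using v finite_W by simp
  finally show "f x = 0" by simp
qed (rule finite_imageI[OF finite_W])

lemma card_delta: "card (delta ` W) = fact n"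
  using card_image[OF inj_on_delta] card_permutations[of "{1..n}" n] by simp

text \<open>Otherwise at most n! - 1 functions would span the n! independent functions
  \<open>delta v\<close>.\<close>

lemma ev_not_in_span:
  assumes s: "s \<in> S" shows "ev s \<notin> fs.span (ev ` (S - {s}))"
proof
  assume "ev s \<in> fs.span (ev ` (S - {s}))"
  then have "fs.span (insert (ev s) (ev ` (S - {s}))) = fs.span (ev ` (S - {s}))"
    by (rule fs.span_redundant)
  moreover have "insert (ev s) (ev ` (S - {s})) = ev ` S" using s by blast
  ultimately have "delta ` W \<subseteq> fs.span (ev ` (S - {s}))" using delta_in_span by auto
  then have "card (delta ` W) \<le> card (ev ` (S - {s}))"
    using fs.independent_span_bound[OF finite_imageI[OF finite_Diff[OF finite_S]] independent_delta]
    by simp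
  also have "\<dots> \<le> card (S - {s})" using finite_S by (intro card_image_le) auto
  also have "\<dots> < card S" using finite_S s by (rule card_Diff1_less)
  finally show False using card_S unfolding card_delta by simp
qed

text \<open>In weight \<open>dg s\<close> the relation expresses \<open>c s\<close> times
  \<open>ev s\<close> through the values of the other elements, up to lower weight; a nonzero
  \<open>c s\<close> would contradict \<open>ev_not_in_span\<close>.\<close>

theorem S_independent:
  assumes "(\<Sum>s\<in>S. const_poly (c s) * s) \<in> I" and s: "s \<in> S"
  shows "c s = 0"
proof (rule ccontr)
  assume cs: "c s \<noteq> 0"
  let ?U = "fs.span (ev ` (S - {s}))"
  have "component (dg s) (\<Sum>s\<in>S. const_poly (c s) * s) \<in> F (dg s)"
    using assms(1) I_subset_K by (auto simp: K_def)
  also have "\<dots> \<subseteq> fs.span (ev ` {t \<in> S. dg t < dg s})" by (rule F_subset_span)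
  \<comment> \<open>The strict inequality of weights excludes \<open>s\<close> itself.\<close>
  also have "\<dots> \<subseteq> ?U" by (intro fs.span_mono) auto
  finally have "(\<Sum>t\<in>S. (\<lambda>w. c t * component (dg s) t w)) \<in> ?U"
    by (simp add: component_sum component_const_mult)
  also have "(\<Sum>t\<in>S. (\<lambda>w. c t * component (dg s) t w)) =
      (\<lambda>w. c s * ev s w) + (\<Sum>t\<in>S-{s}. (\<lambda>w. c t * component (dg s) t w))"
    using finite_S s by (simp add: sum.remove ev_def)
  finally have "(\<lambda>w. c s * ev s w) + (\<Sum>t\<in>S-{s}. (\<lambda>w. c t * component (dg s) t w)) \<in> ?U" .
  moreover have "(\<Sum>t\<in>S-{s}. (\<lambda>w. c t * component (dg s) t w)) \<in> ?U"
  proof (intro fs.span_sum fs.span_scale)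
    fix t assume t: "t \<in> S - {s}"
    then show "component (dg s) t \<in> ?U"
      using component_S[of t "dg s"] by (auto intro: fs.span_base fs.span_zero)
  qed
  ultimately have "(\<lambda>w. c s * ev s w) + (\<Sum>t\<in>S-{s}. (\<lambda>w. c t * component (dg s) t w)) -
      (\<Sum>t\<in>S-{s}. (\<lambda>w. c t * component (dg s) t w)) \<in> ?U"
    by (rule fs.span_diff)
  then have "(\<lambda>w. c s * ev s w) \<in> ?U" by simp
  from fs.span_scale[OF this, of "inverse (c s)"] cs have "ev s \<in> ?U"
    by (simp add: mult.assoc[symmetric])
  with ev_not_in_span[OF s] show False by simp
qed

section \<open>The basis of the quotient\<close>

lemma hess_class_eq_iff:
  assumes "p \<in> C" "q \<in> C"
  shows "hess_class n h p = hess_class n h q \<longleftrightarrow> p - q \<in> I"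
proof -
  interpret R: cring "poly_ring n" by (rule cring_poly_ring)
  show ?thesis
    using R.quotient_eq_iff_same_a_r_cos[OF ideal_hess_ideal[OF h1 hn] assms] assms
    by (simp add: hess_class_def a_minus_def a_inv_poly_ring)
qed

lemma S_sub: "s \<in> S \<Longrightarrow> s \<in> C"
  using x_elements_carrier y_elements_carrier by blast

text \<open>A basis is a set of classes, so a coincidence of classes would hide a dependence. It
  would be a relation with coefficients 1 and -1.\<close>

lemma inj_on_hess_class: "inj_on (hess_class n h) S"
proof (rule inj_onI, rule ccontr)
  fix s t assume st: "s \<in> S" "t \<in> S" "hess_class n h s = hess_class n h t" "s \<noteq> t"
  define c :: "hpoly \<Rightarrow> complex" where "c = (\<lambda>u. if u = s then 1 else if u = t then -1 else 0)"
  have "(\<Sum>u\<in>S. const_poly (c u) * u) = (\<Sum>u\<in>{s, t}. const_poly (c u) * u)"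
    using st finite_S by (intro sum.mono_neutral_right) (auto simp: c_def)
  also have "\<dots> = s - t"
    using st(4) by (simp add: c_def const_poly_1 const_poly_uminus_1)
  also have "\<dots> \<in> I" using st S_sub hess_class_eq_iff by blast
  finally have "c s = 0" using st(1) by (rule S_independent)
  then show False by (simp add: c_def)
qed

theorem basis_S: "vectorspace.basis class_ring (hess_algebra n h) (hess_class n h ` S)"
proof -
  define Q where "Q = poly_ring n Quot I"
  let ?V = "hess_algebra n h"
  interpret ideal I "poly_ring n" by (rule ideal_hess_ideal[OF h1 hn])
  interpret V: vectorspace class_ring ?V by (rule vectorspace_hess_algebra[OF h1 hn])
  have hom: "hess_class n h \<in> Ring.ring_hom (poly_ring n) Q"
    using rcos_ring_hom unfolding Q_def hess_class_def[abs_def] .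
  have V: "carrier ?V = carrier Q" "zero ?V = zero Q" "add ?V = add Q"
    "smult ?V = (\<lambda>c A. hess_class n h (const_poly c) \<otimes>\<^bsub>Q\<^esub> A)"
    by (simp_all add: hess_algebra_def Q_def Let_def)
  have closed: "hess_class n h p \<in> carrier ?V" if "p \<in> C" for p
    using ring_hom_closed[OF hom that] by (simp add: V)
  have zero: "hess_class n h 0 = \<zero>\<^bsub>?V\<^esub>"
    using ring_hom_zero[OF hom] ring_axioms quotient_is_ring by (simp add: V Q_def)
  have smult: "hess_class n h (const_poly c * p) = c \<odot>\<^bsub>?V\<^esub> hess_class n h p" if "p \<in> C" for c p
    using ring_hom_mult[OF hom poly_ring_const that, of c] by (simp add: V)
  have add: "hess_class n h (p + q) = hess_class n h p \<oplus>\<^bsub>?V\<^esub> hess_class n h q"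
    if "p \<in> C" "q \<in> C" for p q
    using ring_hom_add[OF hom that] by (simp add: V)
  \<comment> \<open>Injectivity of the class map turns a combination indexed by classes into the
    class of a combination indexed by polynomials.\<close>
  have lincomb: "V.lincomb a (hess_class n h ` B) =
      hess_class n h (\<Sum>s\<in>B. const_poly (a (hess_class n h s)) * s)" if "B \<subseteq> S" for a B
  proof -
    have "finite B" using finite_S that by (rule rev_finite_subset)
    then show ?thesis using that
    proof (induction B rule: finite_induct)
      case empty
      then show ?case by (simp add: V.lincomb_def zero)
    next
      case (insert s B)
      have sum: "(\<Sum>s\<in>B. const_poly (a (hess_class n h s)) * s) \<in> C"
        using insert.prems S_sub by (intro poly_ring_closed) auto
      have s: "s \<in> C" using insert.prems S_sub by blast
      have "hess_class n h s \<notin> hess_class n h ` B"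
        using insert.hyps(2) insert.prems inj_on_image_mem_iff[OF inj_on_hess_class, of s B] by blast
      moreover have "(\<lambda>v. a v \<odot>\<^bsub>?V\<^esub> v) \<in> hess_class n h ` B \<rightarrow> carrier ?V"
        using insert.prems S_sub closed by (auto intro!: V.smult_closed)
      moreover have "a (hess_class n h s) \<odot>\<^bsub>?V\<^esub> hess_class n h s \<in> carrier ?V"
        using closed[OF s] by (auto intro!: V.smult_closed)
      ultimately have "V.lincomb a (hess_class n h ` insert s B) =
          a (hess_class n h s) \<odot>\<^bsub>?V\<^esub> hess_class n h s \<oplus>\<^bsub>?V\<^esub> V.lincomb a (hess_class n h ` B)"
        using insert.hyps by (simp add: V.lincomb_def)
      also have "\<dots> = hess_class n h (const_poly (a (hess_class n h s)) * s) \<oplus>\<^bsub>?V\<^esub>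
          hess_class n h (\<Sum>s\<in>B. const_poly (a (hess_class n h s)) * s)"
        using insert by (simp add: smult[OF s])
      also have "\<dots> = hess_class n h (\<Sum>s\<in>insert s B. const_poly (a (hess_class n h s)) * s)"
        using insert.hyps by (simp add: add[OF poly_ring_mult[OF poly_ring_const s] sum])
      finally show ?case .
    qed
  qed
  have "V.lin_indpt (hess_class n h ` S)"
  proof
    assume "V.lin_dep (hess_class n h ` S)"
    then obtain A a v where A: "finite A" "A \<subseteq> hess_class n h ` S" "V.lincomb a A = \<zero>\<^bsub>?V\<^esub>"
        "v \<in> A" "a v \<noteq> 0"
      unfolding V.lin_dep_def by auto
    from A(2) obtain B where B: "B \<subseteq> S" "A = hess_class n h ` B" by (auto simp: subset_image_iff)
    \<comment> \<open>Coefficients are extended by 0 to all of \<open>S\<close>, over which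
      \<open>S_independent\<close> sums.\<close>
    define c where "c = (\<lambda>s. if s \<in> B then a (hess_class n h s) else 0)"
    have sum: "(\<Sum>s\<in>B. const_poly (a (hess_class n h s)) * s) = (\<Sum>s\<in>S. const_poly (c s) * s)"
      using finite_S B(1) by (intro sum.mono_neutral_cong_left) (auto simp: c_def)
    have "hess_class n h (\<Sum>s\<in>S. const_poly (c s) * s) = hess_class n h 0"
      using lincomb[OF B(1), of a] A(3) B(2) by (simp add: zero sum)
    moreover have "(\<Sum>s\<in>S. const_poly (c s) * s) \<in> C"
      using S_sub by (intro poly_ring_closed) auto
    ultimately have "(\<Sum>s\<in>S. const_poly (c s) * s) \<in> I"
      using hess_class_eq_iff[of _ 0] by (simp add: poly_ring_zero)
    moreover obtain s where s: "s \<in> B" "v = hess_class n h s" using A(4) B(2) by blast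
    ultimately have "c s = 0" using B(1) by (intro S_independent[of c s]) auto
    then show False using A(5) s by (simp add: c_def)
  qed
  moreover have sub: "hess_class n h ` S \<subseteq> carrier ?V" using closed S_sub by blast
  moreover have "V.span (hess_class n h ` S) = carrier ?V"
  proof
    show "V.span (hess_class n h ` S) \<subseteq> carrier ?V" using sub by (rule V.span_is_subset2)
    show "carrier ?V \<subseteq> V.span (hess_class n h ` S)"
    proof
      fix A assume "A \<in> carrier ?V"
      then obtain p where p: "p \<in> C" "A = hess_class n h p"
        by (auto simp: V Q_def FactRing_def A_RCOSETS_def' hess_class_def)
      from C_in_T[OF p(1)] obtain c where c: "p - (\<Sum>s\<in>S. const_poly (c s) * s) \<in> I"
        by (auto simp: T_def)
      \<comment> \<open>The coefficients are carried over to classes by inverting the class map on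
        \<open>S\<close>.\<close>
      define a where "a = c \<circ> inv_into S (hess_class n h)"
      have "V.lincomb a (hess_class n h ` S) = hess_class n h (\<Sum>s\<in>S. const_poly (a (hess_class n h s)) * s)"
        by (rule lincomb) simp
      also have "(\<Sum>s\<in>S. const_poly (a (hess_class n h s)) * s) = (\<Sum>s\<in>S. const_poly (c s) * s)"
        by (intro sum.cong) (auto simp: a_def inj_on_hess_class)
      also have "hess_class n h \<dots> = A"
      proof -
        have "(\<Sum>s\<in>S. const_poly (c s) * s) \<in> C" using S_sub by (intro poly_ring_closed) auto
        from hess_class_eq_iff[OF p(1) this] c p(2) show ?thesis by simp
      qed
      finally show "A \<in> V.span (hess_class n h ` S)"
        unfolding V.span_def using finite_S by (auto intro!: exI[of _ a] exI[of _ "hess_class n h ` S"])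
    qed
  qed
  ultimately show ?thesis unfolding V.basis_def by blast
qed

end

theorem theoremA:
  fixes n :: nat and h :: "nat \<Rightarrow> nat"
  assumes "n \<ge> 2"
    and "1 \<le> h 1" and "h 1 \<le> n"
    and "\<forall>i\<in>{2..n}. h i = n"
  shows "inj_on (hess_class n (h 1)) (x_elements n (h 1) \<union> y_elements n (h 1)) \<and>
         vectorspace.basis class_ring (hess_algebra n (h 1))
           (hess_class n (h 1) ` (x_elements n (h 1) \<union> y_elements n (h 1)))"
proof -
  interpret hessenberg n "h 1" by unfold_locales (use assms in auto)
  show ?thesis using inj_on_hess_class basis_S by blast
qed

end
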